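(* Let $\psi$ be a QCBF instance. Given a tree-like clause judgement proof $P$ (viewed as a tree) of an empty clause, there exists a trace $E$ of $\psi$ whose root has label $(\emptyset,e)$ and whose number of nodes equals the number of non-flow judgements in $P$. Moreover, the translation from $P$ to $E$ is computable in polynomial time.
   Context: A literal is a propositional variable $v$ or its negation $\overline{v}$; $v,\overline{v}$ are complementary. A clause is a disjunction of literals with at most one literal on each variable (also a set of literals); empty if it has no literals; $\mathrm{vars}(\alpha)$ is its set of variables. $\gamma$ is a resolvent of $\alpha,\beta$ if there is $L\in\alpha$ with complement $M\in\beta$ and $\gamma=(\alpha\setminus\{L\})\cup(\beta\setminus\{M\})$ is a clause. A clause $\gamma$ is falsified by assignment $a$ if $a$ is defined on $\mathrm{vars}(\gamma)$ and every literal of $\gamma$ is false under $a$. A QCBF instance is a propositional formula without free variables built from clauses, conjunction and $\forall/\exists$ quantification; $I_\psi$ has one index per subformula occurrence (a clause has no proper subformulas), $\psi(i)$ is the subformula at $i$, parent/child refer to the syntax tree. A clause judgement is $(i,\alpha)$ with $\mathrm{vars}(\alpha)\subseteq\mathrm{free}(\psi(i))$. A clause judgement proof is a finite sequence of clause judgements each of one of the types: (clause) $(i,\alpha)$ with $\psi(i)$ the clause $\alpha$; (resolve) $(i,\gamma)$ from previous $(i,\alpha),(i,\beta)$ with $\gamma$ a resolvent of $\alpha,\beta$; (upward flow) $(i,\alpha)$ from previous $(j,\alpha)$, $i$ the parent of $j$; ($\forall$-removal) $(i,\alpha\setminus\{y,\overline{y}\})$ from previous $(j,\alpha)$ with $\psi(i)=\forall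 y\,\psi(j)$, $i$ the parent of $j$; (downward flow) $(j,\alpha)$ from previous $(i,\alpha)$, $i$ the parent of $j$. Non-flow judgements are those not derived by (upward flow) or (downward flow). A judgement derived using a previous judgement $J$ is a successor of $J$, and $J$ a predecessor of it. A proof is tree-like if each judgement has at most one successor; then each judgement induces a tree rooted at it whose root's children are the trees of its predecessors; a tree-like proof of an empty clause is the tree induced by an empty clause judgement. $i\le_\psi j$ means $i$ lies on the path from $j$ to the root; $i<_\psi j$ means additionally $i\neq j$. A located variable is $(i,u)$ with $u$ quantified at location $i$; $\forall$-located if universally quantified. An index $j$ follows $(i,u)$ if $i<_\psi j$ and $u\in\mathrm{free}(\psi(k))$ for all $k$ with $i<_\psi k\le_\psi j$; a located variable $(j,v)$ follows $(i,u)$ if $j$ does; following a set $S$ means following each element. $S$ is coherent if of any two distinct elements one follows the other. $\mathrm{vars}(S)$ is the set of variables in $S$. $e$ is the unique assignment $\emptyset\to\{0,1\}$; $a\upharpoonright X$ is restriction and $a[u\to b]$ extension. A trace of $\psi$ is a rooted tree, each node labelled $(S,a)$ with $S$ a coherent set of located variables and $a:\mathrm{vars}(S)\to\{0,1\}$, each node having $0$, $1$ or $2$ children, such that: a node $(S,a)$ with $2$ children has children labelled $(S_0\cup\{(i,u)\},(a\upharpoonright\mathrm{vars}(S_0))[u\to 0])$ and $(S_1\cup\{(i,u)\},(a\upharpoonright\mathrm{vars}(S_1))[u\to 1])$ for some located variable $(i,u)\notin S$ with $S\cup\{(i,u)\}$ coherent and $S_0,S_1\subseteq S$ with $S_0\cup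 S_1=S$; a node with $1$ child has child labelled $(S\cup\{(i,y)\},a[y\to b])$ for some $\forall$-located $(i,y)$ following $S$ and $b\in\{0,1\}$; a node with $0$ children has an index $i$ following $S$ such that $\psi(i)$ is a clause falsified by $a$ with $\mathrm{vars}(\psi(i))=\mathrm{vars}(S)$. *)

theory Defs
  imports Main "HOL-Library.Sublist"
begin

section \<open>Clauses and QCBF instances\<close>

datatype literal = Pos nat | Neg nat

fun var_of :: "literal \<Rightarrow> nat" where
  "var_of (Pos v) = v"
| "var_of (Neg v) = v"

fun complement :: "literal \<Rightarrow> literal" where
  "complement (Pos v) = Neg v"
| "complement (Neg v) = Pos v"

type_synonym clause = "literal set"

definition is_clause :: "clause \<Rightarrow> bool" where
  "is_clause \<alpha> \<longleftrightarrow> finite \<alpha> \<and> (\<forall>v. \<not> (Pos v \<in> \<alpha> \<and> Neg v \<in> \<alpha>))"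

definition vars_clause :: "clause \<Rightarrow> nat set" where
  "vars_clause \<alpha> = var_of ` \<alpha>"

definition is_resolvent :: "clause \<Rightarrow> clause \<Rightarrow> clause \<Rightarrow> bool" where
  "is_resolvent \<gamma> \<alpha> \<beta> \<longleftrightarrow>
     (\<exists>L\<in>\<alpha>. complement L \<in> \<beta> \<and> \<gamma> = (\<alpha> - {L}) \<union> (\<beta> - {complement L}) \<and> is_clause \<gamma>)"

fun literal_false :: "(nat \<rightharpoonup> bool) \<Rightarrow> literal \<Rightarrow> bool" where
  "literal_false a (Pos v) \<longleftrightarrow> a v = Some False"
| "literal_false a (Neg v) \<longleftrightarrow> a v = Some True"

definition falsified :: "clause \<Rightarrow> (nat \<rightharpoonup> bool) \<Rightarrow> bool" where
  "falsified \<gamma> a \<longleftrightarrow> vars_clause \<gamma> \<subseteq> dom a \<and> (\<forall>L\<in>\<gamma>. literal_false a L)"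

datatype qcbf = Cl clause | Conj qcbf qcbf | QAll nat qcbf | QEx nat qcbf

fun free :: "qcbf \<Rightarrow> nat set" where
  "free (Cl \<alpha>) = vars_clause \<alpha>"
| "free (Conj \<phi> \<chi>) = free \<phi> \<union> free \<chi>"
| "free (QAll v \<phi>) = free \<phi> - {v}"
| "free (QEx v \<phi>) = free \<phi> - {v}"

fun wf_qcbf :: "qcbf \<Rightarrow> bool" where
  "wf_qcbf (Cl \<alpha>) = is_clause \<alpha>"
| "wf_qcbf (Conj \<phi> \<chi>) = (wf_qcbf \<phi> \<and> wf_qcbf \<chi>)"
| "wf_qcbf (QAll v \<phi>) = wf_qcbf \<phi>"
| "wf_qcbf (QEx v \<phi>) = wf_qcbf \<phi>"

definition qcbf_instance :: "qcbf \<Rightarrow> bool" where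
  "qcbf_instance \<psi> \<longleftrightarrow> wf_qcbf \<psi> \<and> free \<psi> = {}"

text \<open>
  A subformula occurrence is addressed by the path leading to it from the root of the syntax
  tree: \<open>False\<close> goes to the left conjunct or to the body of a quantifier, \<open>True\<close> to the right
  conjunct.  The ancestors of an index are thus its prefixes.
\<close>

type_synonym index = "bool list"

fun subformula :: "qcbf \<Rightarrow> index \<Rightarrow> qcbf option" where
  "subformula \<psi> [] = Some \<psi>"
| "subformula (Conj \<phi> \<chi>) (b # i) = subformula (if b then \<chi> else \<phi>) i"
| "subformula (QAll v \<phi>) (b # i) = (if b then None else subformula \<phi> i)"
| "subformula (QEx v \<phi>) (b # i) = (if b then None else subformula \<phi> i)"
| "subformula (Cl \<alpha>) (b # i) = None"

definition indices :: "qcbf \<Rightarrow> index set" where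
  "indices \<psi> = {i. subformula \<psi> i \<noteq> None}"

abbreviation sub_at :: "qcbf \<Rightarrow> index \<Rightarrow> qcbf" where
  "sub_at \<psi> i \<equiv> the (subformula \<psi> i)"

definition is_parent :: "qcbf \<Rightarrow> index \<Rightarrow> index \<Rightarrow> bool" where
  "is_parent \<psi> i j \<longleftrightarrow> i \<in> indices \<psi> \<and> j \<in> indices \<psi> \<and> (\<exists>b. j = i @ [b])"


section \<open>Clause judgement proofs\<close>

type_synonym judgement = "index \<times> clause"

definition clause_judgement :: "qcbf \<Rightarrow> judgement \<Rightarrow> bool" where
  "clause_judgement \<psi> J \<longleftrightarrow>
     (case J of (i, \<alpha>) \<Rightarrow>
        i \<in> indices \<psi> \<and> is_clause \<alpha> \<and> vars_clause \<alpha> \<subseteq> free (sub_at \<psi> i))"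

text \<open>In the inference types, the list argument consists of the predecessors.\<close>

definition by_clause :: "qcbf \<Rightarrow> judgement list \<Rightarrow> judgement \<Rightarrow> bool" where
  "by_clause \<psi> Js J \<longleftrightarrow>
     (\<exists>i \<alpha>. Js = [] \<and> J = (i, \<alpha>) \<and> i \<in> indices \<psi> \<and> sub_at \<psi> i = Cl \<alpha>)"

definition by_resolve :: "qcbf \<Rightarrow> judgement list \<Rightarrow> judgement \<Rightarrow> bool" where
  "by_resolve \<psi> Js J \<longleftrightarrow>
     (\<exists>i \<alpha> \<beta> \<gamma>. Js = [(i, \<alpha>), (i, \<beta>)] \<and> J = (i, \<gamma>) \<and> is_resolvent \<gamma> \<alpha> \<beta>)"

definition by_upward_flow :: "qcbf \<Rightarrow> judgement list \<Rightarrow> judgement \<Rightarrow> bool" where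
  "by_upward_flow \<psi> Js J \<longleftrightarrow>
     (\<exists>i j \<alpha>. Js = [(j, \<alpha>)] \<and> J = (i, \<alpha>) \<and> is_parent \<psi> i j)"

definition by_all_removal :: "qcbf \<Rightarrow> judgement list \<Rightarrow> judgement \<Rightarrow> bool" where
  "by_all_removal \<psi> Js J \<longleftrightarrow>
     (\<exists>i j \<alpha> y. Js = [(j, \<alpha>)] \<and> J = (i, \<alpha> - {Pos y, Neg y}) \<and> is_parent \<psi> i j \<and>
        sub_at \<psi> i = QAll y (sub_at \<psi> j))"

definition by_downward_flow :: "qcbf \<Rightarrow> judgement list \<Rightarrow> judgement \<Rightarrow> bool" where
  "by_downward_flow \<psi> Js J \<longleftrightarrow>
     (\<exists>i j \<alpha>. Js = [(i, \<alpha>)] \<and> J = (j, \<alpha>) \<and> is_parent \<psi> i j)"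

text \<open>
  Every element of a proof carries the positions of the judgements it is derived from; this
  determines successors and predecessors.
\<close>

type_synonym cj_proof = "(judgement \<times> nat list) list"

definition judgement_at :: "cj_proof \<Rightarrow> nat \<Rightarrow> judgement" where
  "judgement_at \<Pi> k = fst (\<Pi> ! k)"

definition preds_at :: "cj_proof \<Rightarrow> nat \<Rightarrow> nat list" where
  "preds_at \<Pi> k = snd (\<Pi> ! k)"

definition is_cj_proof :: "qcbf \<Rightarrow> cj_proof \<Rightarrow> bool" where
  "is_cj_proof \<psi> \<Pi> \<longleftrightarrow>
     (\<forall>k<length \<Pi>.
        let J = judgement_at \<Pi> k; Js = map (judgement_at \<Pi>) (preds_at \<Pi> k) in
          clause_judgement \<psi> J \<and> (\<forall>p\<in>set (preds_at \<Pi> k). p < k) \<and>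
          (by_clause \<psi> Js J \<or> by_resolve \<psi> Js J \<or> by_upward_flow \<psi> Js J \<or>
           by_all_removal \<psi> Js J \<or> by_downward_flow \<psi> Js J))"

definition tree_like :: "cj_proof \<Rightarrow> bool" where
  "tree_like \<Pi> \<longleftrightarrow>
     (\<forall>p<length \<Pi>. card {k. k < length \<Pi> \<and> p \<in> set (preds_at \<Pi> k)} \<le> 1)"

datatype 'a rtree = RNode (root_label: 'a) (children: "'a rtree list")

fun num_nodes :: "'a rtree \<Rightarrow> nat" where
  "num_nodes (RNode x ts) = Suc (sum_list (map num_nodes ts))"

text \<open>
  The filter only serves termination: in a clause judgement proof all predecessors of the
  judgement at position \<open>k\<close> are at positions below \<open>k\<close>.
\<close>

fun induced_tree :: "cj_proof \<Rightarrow> nat \<Rightarrow> judgement rtree" where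
  "induced_tree \<Pi> k =
     RNode (judgement_at \<Pi> k) (map (induced_tree \<Pi>) (filter (\<lambda>p. p < k) (preds_at \<Pi> k)))"

declare induced_tree.simps [simp del]

definition tree_like_empty_clause_proof :: "qcbf \<Rightarrow> judgement rtree \<Rightarrow> bool" where
  "tree_like_empty_clause_proof \<psi> P \<longleftrightarrow>
     (\<exists>\<Pi> k. is_cj_proof \<psi> \<Pi> \<and> tree_like \<Pi> \<and> k < length \<Pi> \<and>
        snd (judgement_at \<Pi> k) = {} \<and> P = induced_tree \<Pi> k)"

text \<open>
  A removal of \<open>y\<close> from a clause that does not mention \<open>y\<close> is literally an upward flow, and is
  counted as one.
\<close>

fun num_nonflow :: "qcbf \<Rightarrow> judgement rtree \<Rightarrow> nat" where
  "num_nonflow \<psi> (RNode J ts) =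
     (if by_upward_flow \<psi> (map root_label ts) J \<or> by_downward_flow \<psi> (map root_label ts) J then 0 else 1)
     + sum_list (map (num_nonflow \<psi>) ts)"


section \<open>Traces\<close>

type_synonym located_var = "index \<times> nat"

definition forall_located :: "qcbf \<Rightarrow> located_var \<Rightarrow> bool" where
  "forall_located \<psi> x \<longleftrightarrow>
     (case x of (i, u) \<Rightarrow> i \<in> indices \<psi> \<and> (\<exists>\<phi>. sub_at \<psi> i = QAll u \<phi>))"

definition located :: "qcbf \<Rightarrow> located_var \<Rightarrow> bool" where
  "located \<psi> x \<longleftrightarrow>
     (case x of (i, u) \<Rightarrow>
        i \<in> indices \<psi> \<and> (\<exists>\<phi>. sub_at \<psi> i = QAll u \<phi> \<or> sub_at \<psi> i = QEx u \<phi>))"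

definition index_follows :: "qcbf \<Rightarrow> index \<Rightarrow> located_var \<Rightarrow> bool" where
  "index_follows \<psi> j x \<longleftrightarrow>
     (case x of (i, u) \<Rightarrow>
        j \<in> indices \<psi> \<and> strict_prefix i j \<and>
        (\<forall>k. strict_prefix i k \<and> prefix k j \<longrightarrow> u \<in> free (sub_at \<psi> k)))"

definition index_follows_set :: "qcbf \<Rightarrow> index \<Rightarrow> located_var set \<Rightarrow> bool" where
  "index_follows_set \<psi> j S \<longleftrightarrow> (\<forall>x\<in>S. index_follows \<psi> j x)"

definition follows :: "qcbf \<Rightarrow> located_var \<Rightarrow> located_var \<Rightarrow> bool" where
  "follows \<psi> y x \<longleftrightarrow> index_follows \<psi> (fst y) x"

definition follows_set :: "qcbf \<Rightarrow> located_var \<Rightarrow> located_var set \<Rightarrow> bool" where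
  "follows_set \<psi> y S \<longleftrightarrow> (\<forall>x\<in>S. follows \<psi> y x)"

definition coherent :: "qcbf \<Rightarrow> located_var set \<Rightarrow> bool" where
  "coherent \<psi> S \<longleftrightarrow> (\<forall>x\<in>S. \<forall>y\<in>S. x \<noteq> y \<longrightarrow> follows \<psi> x y \<or> follows \<psi> y x)"

definition vars_located :: "located_var set \<Rightarrow> nat set" where
  "vars_located S = snd ` S"

type_synonym trace_label = "located_var set \<times> (nat \<rightharpoonup> bool)"

definition wf_label :: "qcbf \<Rightarrow> trace_label \<Rightarrow> bool" where
  "wf_label \<psi> l \<longleftrightarrow>
     (case l of (S, a) \<Rightarrow>
        (\<forall>x\<in>S. located \<psi> x) \<and> coherent \<psi> S \<and> dom a = vars_located S)"

text \<open>The children of a trace node are unordered, hence the two cases for the list \<open>ts\<close>.\<close>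

inductive is_trace :: "qcbf \<Rightarrow> trace_label rtree \<Rightarrow> bool" for \<psi> where
  no_child:
    "\<lbrakk> wf_label \<psi> (S, a);
       i \<in> indices \<psi>; index_follows_set \<psi> i S;
       sub_at \<psi> i = Cl \<gamma>; falsified \<gamma> a; vars_clause \<gamma> = vars_located S \<rbrakk>
     \<Longrightarrow> is_trace \<psi> (RNode (S, a) [])"
| one_child:
    "\<lbrakk> wf_label \<psi> (S, a);
       forall_located \<psi> (i, y); follows_set \<psi> (i, y) S;
       is_trace \<psi> t; root_label t = (S \<union> {(i, y)}, a(y \<mapsto> b)) \<rbrakk>
     \<Longrightarrow> is_trace \<psi> (RNode (S, a) [t])"
| two_children:
    "\<lbrakk> wf_label \<psi> (S, a);
       located \<psi> (i, u); (i, u) \<notin> S; coherent \<psi> (S \<union> {(i, u)});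
       S0 \<subseteq> S; S1 \<subseteq> S; S0 \<union> S1 = S;
       is_trace \<psi> t0; root_label t0 = (S0 \<union> {(i, u)}, (a |` vars_located S0)(u \<mapsto> False));
       is_trace \<psi> t1; root_label t1 = (S1 \<union> {(i, u)}, (a |` vars_located S1)(u \<mapsto> True));
       ts = [t0, t1] \<or> ts = [t1, t0] \<rbrakk>
     \<Longrightarrow> is_trace \<psi> (RNode (S, a) ts)"


section \<open>Polynomial-time computability\<close>

text \<open>
  The model of computation is a first-order, call-by-value functional language with general
  recursion over binary trees (pure LISP with a single atom).  A program is a list of function
  bodies, a body refers to its arguments by position, and function \<open>0\<close> is the main function.
  Projections of \<open>Nl\<close> are \<open>Nl\<close>, and \<open>Nl\<close> is the truth value false.

  Each evaluation step is charged the full size of the tree it produces, i.e. trees count as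
  copied and never as shared.  Hence all intermediate results are bounded in size by the running
  time, and the running time is polynomially related to that of a Turing machine operating on the
  same trees written as strings.
\<close>

datatype sexp = Nl | Pr sexp sexp

fun sexp_size :: "sexp \<Rightarrow> nat" where
  "sexp_size Nl = 1"
| "sexp_size (Pr x y) = Suc (sexp_size x + sexp_size y)"

fun sexp_fst :: "sexp \<Rightarrow> sexp" where
  "sexp_fst Nl = Nl"
| "sexp_fst (Pr x y) = x"

fun sexp_snd :: "sexp \<Rightarrow> sexp" where
  "sexp_snd Nl = Nl"
| "sexp_snd (Pr x y) = y"

datatype exp =
    ArgE nat
  | NlE
  | PrE exp exp
  | FstE exp
  | SndE exp
  | IfE exp exp exp
  | CallE nat "exp list"

type_synonym program = "exp list"

text \<open>
  \<open>eval p vs e v t\<close>: with arguments \<open>vs\<close>, the expression \<open>e\<close> evaluates to \<open>v\<close> in time \<open>t\<close>.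
\<close>

inductive eval :: "program \<Rightarrow> sexp list \<Rightarrow> exp \<Rightarrow> sexp \<Rightarrow> nat \<Rightarrow> bool"
  and evals :: "program \<Rightarrow> sexp list \<Rightarrow> exp list \<Rightarrow> sexp list \<Rightarrow> nat \<Rightarrow> bool"
  for p where
  eval_ArgE: "n < length vs \<Longrightarrow> eval p vs (ArgE n) (vs ! n) (sexp_size (vs ! n))"
| eval_NlE: "eval p vs NlE Nl (sexp_size Nl)"
| eval_PrE: "\<lbrakk> eval p vs e1 v1 t1; eval p vs e2 v2 t2 \<rbrakk>
     \<Longrightarrow> eval p vs (PrE e1 e2) (Pr v1 v2) (t1 + t2 + sexp_size (Pr v1 v2))"
| eval_FstE: "eval p vs e v t \<Longrightarrow> eval p vs (FstE e) (sexp_fst v) (t + sexp_size (sexp_fst v))"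
| eval_SndE: "eval p vs e v t \<Longrightarrow> eval p vs (SndE e) (sexp_snd v) (t + sexp_size (sexp_snd v))"
| eval_IfE_true: "\<lbrakk> eval p vs e v t; v \<noteq> Nl; eval p vs e1 v1 t1 \<rbrakk>
     \<Longrightarrow> eval p vs (IfE e e1 e2) v1 (t + t1 + sexp_size v1)"
| eval_IfE_false: "\<lbrakk> eval p vs e Nl t; eval p vs e2 v2 t2 \<rbrakk>
     \<Longrightarrow> eval p vs (IfE e e1 e2) v2 (t + t2 + sexp_size v2)"
| eval_CallE: "\<lbrakk> evals p vs es ws t; f < length p; eval p ws (p ! f) v t' \<rbrakk>
     \<Longrightarrow> eval p vs (CallE f es) v (t + t' + sexp_size v)"
| evals_Nil: "evals p vs [] [] 0"
| evals_Cons: "\<lbrakk> eval p vs e v t; evals p vs es ws t' \<rbrakk>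
     \<Longrightarrow> evals p vs (e # es) (v # ws) (t + t')"

text \<open>
  The objects to be computed with are given by representations: \<open>R x w\<close> means that the tree \<open>w\<close>
  represents \<open>x\<close>.  An object may have several representations since sets are represented by
  arbitrary repetition-free enumerations; a program has to cope with each of them.
\<close>

definition polytime_computable_on ::
  "'a set \<Rightarrow> ('a \<Rightarrow> sexp \<Rightarrow> bool) \<Rightarrow> ('b \<Rightarrow> sexp \<Rightarrow> bool) \<Rightarrow> ('a \<Rightarrow> 'b) \<Rightarrow> bool" where
  "polytime_computable_on D R Q f \<longleftrightarrow>
     (\<exists>p c d. \<forall>x\<in>D. \<forall>w. R x w \<longrightarrow>
        (\<exists>w' t. eval p [w] (CallE 0 [ArgE 0]) w' t \<and> Q (f x) w' \<and> t \<le> c * sexp_size w ^ d))"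

fun enc_bool :: "bool \<Rightarrow> sexp" where
  "enc_bool False = Nl"
| "enc_bool True = Pr Nl Nl"

text \<open>Binary notation, least significant bit first.\<close>

fun enc_nat :: "nat \<Rightarrow> sexp" where
  "enc_nat n = (if n = 0 then Nl else Pr (enc_bool (odd n)) (enc_nat (n div 2)))"

declare enc_nat.simps [simp del]

fun enc_list :: "sexp list \<Rightarrow> sexp" where
  "enc_list [] = Nl"
| "enc_list (x # xs) = Pr x (enc_list xs)"

definition rep_set :: "('a \<Rightarrow> sexp) \<Rightarrow> 'a set \<Rightarrow> sexp \<Rightarrow> bool" where
  "rep_set enc X w \<longleftrightarrow> (\<exists>xs. distinct xs \<and> set xs = X \<and> w = enc_list (map enc xs))"

inductive rep_rtree :: "('a \<Rightarrow> sexp \<Rightarrow> bool) \<Rightarrow> 'a rtree \<Rightarrow> sexp \<Rightarrow> bool" for R where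
  "\<lbrakk> R l x; list_all2 (rep_rtree R) ts ws \<rbrakk>
   \<Longrightarrow> rep_rtree R (RNode l ts) (Pr x (enc_list ws))"

fun enc_literal :: "literal \<Rightarrow> sexp" where
  "enc_literal (Pos v) = Pr (enc_bool True) (enc_nat v)"
| "enc_literal (Neg v) = Pr (enc_bool False) (enc_nat v)"

fun rep_qcbf :: "qcbf \<Rightarrow> sexp \<Rightarrow> bool" where
  "rep_qcbf (Cl \<alpha>) w \<longleftrightarrow> (\<exists>x. rep_set enc_literal \<alpha> x \<and> w = Pr (enc_nat 0) x)"
| "rep_qcbf (Conj \<phi> \<chi>) w \<longleftrightarrow>
     (\<exists>x y. rep_qcbf \<phi> x \<and> rep_qcbf \<chi> y \<and> w = Pr (enc_nat 1) (Pr x y))"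
| "rep_qcbf (QAll v \<phi>) w \<longleftrightarrow> (\<exists>x. rep_qcbf \<phi> x \<and> w = Pr (enc_nat 2) (Pr (enc_nat v) x))"
| "rep_qcbf (QEx v \<phi>) w \<longleftrightarrow> (\<exists>x. rep_qcbf \<phi> x \<and> w = Pr (enc_nat 3) (Pr (enc_nat v) x))"

definition enc_index :: "index \<Rightarrow> sexp" where
  "enc_index i = enc_list (map enc_bool i)"

definition rep_judgement :: "judgement \<Rightarrow> sexp \<Rightarrow> bool" where
  "rep_judgement J w \<longleftrightarrow>
     (\<exists>x. rep_set enc_literal (snd J) x \<and> w = Pr (enc_index (fst J)) x)"

definition rep_input :: "qcbf \<times> judgement rtree \<Rightarrow> sexp \<Rightarrow> bool" where
  "rep_input X w \<longleftrightarrow>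
     (\<exists>x y. rep_qcbf (fst X) x \<and> rep_rtree rep_judgement (snd X) y \<and> w = Pr x y)"

definition enc_located_var :: "located_var \<Rightarrow> sexp" where
  "enc_located_var x = Pr (enc_index (fst x)) (enc_nat (snd x))"

definition enc_binding :: "nat \<times> bool \<Rightarrow> sexp" where
  "enc_binding x = Pr (enc_nat (fst x)) (enc_bool (snd x))"

definition rep_trace_label :: "trace_label \<Rightarrow> sexp \<Rightarrow> bool" where
  "rep_trace_label l w \<longleftrightarrow>
     (\<exists>x y. rep_set enc_located_var (fst l) x \<and> rep_set enc_binding (Map.graph (snd l)) y \<and>
        w = Pr x y)"

end

theory Submission
  imports Defs
begin

text \<open>
  A judgement \<open>(i, \<alpha>)\<close> is translated into a trace node labelled by the located variables that bind
  the variables of \<open>\<alpha>\<close> at \<open>i\<close>, together with the assignment that falsifies \<open>\<alpha>\<close>.  Since the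
  instance has no free variables, each variable free at \<open>i\<close> has exactly one located variable that
  \<open>i\<close> follows, so a flow step does not change the label and is contracted.  Clause judgements
  become leaves, resolution steps become nodes with two children branching on the resolved variable,
  and proper removals become nodes with one child.

  The binder of a variable at \<open>i\<close> is found by walking from the root to \<open>i\<close>, so the translation is
  computed by a recursive program whose running time is bounded by a polynomial of degree five.
\<close>


section \<open>Binders\<close>

text \<open>Resolution is read against the direction of the proof. If \<open>\<gamma>\<close> arises
  from \<open>\<alpha>\<close> and \<open>\<beta>\<close> by resolving on \<open>u\<close>, then the
  assignment falsifying \<open>\<gamma>\<close>, extended at \<open>u\<close>, falsifies the premise
  whose literal on \<open>u\<close> it makes false, and a clause has only one falsifying assignment
  on its own variables. So the judgement determines the assignment of its label, and
  \<open>S0\<close> and \<open>S1\<close> in a trace are the binders of what remains of the two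
  premises. Evaluation is a relation with exact times, too fine to follow by hand. Hence only values
  and upper bounds are tracked. Every bound refers to one \<open>N\<close> above the sizes of all
  arguments and is linear in the argument consumed by the recursion, so each nested traversal costs
  one factor N: comparing variable codes N^2, finding a binder N^3, a list of binders N^4, the whole
  tree N^5. Since sets come in arbitrary enumerations, the program maps along the enumeration it is
  given and keeps its order.\<close>

fun child_formula :: "qcbf \<Rightarrow> bool \<Rightarrow> qcbf" where
  "child_formula (Cl \<alpha>) b = Cl \<alpha>"
| "child_formula (Conj \<phi> \<chi>) b = (if b then \<chi> else \<phi>)"
| "child_formula (QAll v \<phi>) b = \<phi>"
| "child_formula (QEx v \<phi>) b = \<phi>"

fun quantifies :: "qcbf \<Rightarrow> nat \<Rightarrow> bool" where
  "quantifies (Cl \<alpha>) v = False"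
| "quantifies (Conj \<phi> \<chi>) v = False"
| "quantifies (QAll u \<phi>) v = (u = v)"
| "quantifies (QEx u \<phi>) v = (u = v)"

text \<open>The result from below takes precedence, so the deepest quantifier on \<open>v\<close>
  strictly above the index is found. The base case is \<open>None\<close> even at a quantifier,
  because a quantifier at the index itself binds nothing that is free there.\<close>

fun binding_index :: "qcbf \<Rightarrow> index \<Rightarrow> nat \<Rightarrow> index option" where
  "binding_index \<phi> [] v = None"
| "binding_index \<phi> (b # i) v =
     (case binding_index (child_formula \<phi> b) i v of
        Some j \<Rightarrow> Some (b # j)
      | None \<Rightarrow> if quantifies \<phi> v then Some [] else None)"

text \<open>\<open>child_formula\<close> is total and returns junk for a bit that leads nowhere; the
  guard that \<open>b # i\<close> is an index excludes this.\<close>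

lemma subformula_child:
  "subformula \<psi> (b # i) \<noteq> None \<Longrightarrow>
     subformula \<psi> (b # k) = subformula (child_formula \<psi> b) k"
  by (cases \<psi>) (auto split: if_splits)

lemma free_child: "v \<in> free (child_formula \<psi> b) \<Longrightarrow> \<not> quantifies \<psi> v \<Longrightarrow> v \<in> free \<psi>"
  by (cases \<psi>) (auto split: if_splits)

lemma subformula_append:
  "subformula \<psi> (i @ j) = Option.bind (subformula \<psi> i) (\<lambda>\<phi>. subformula \<phi> j)"
  by (induction \<psi> i rule: subformula.induct) auto

lemma indices_prefix: "j \<in> indices \<psi> \<Longrightarrow> prefix i j \<Longrightarrow> i \<in> indices \<psi>"
  by (cases "subformula \<psi> i") (auto simp: indices_def prefix_def subformula_append)

lemma located_iff: "located \<psi> (j, v) \<longleftrightarrow> j \<in> indices \<psi> \<and> quantifies (sub_at \<psi> j) v"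
  by (cases "sub_at \<psi> j") (auto simp: located_def)

lemma quantifies_not_free: "quantifies \<phi> v \<Longrightarrow> v \<notin> free \<phi>"
  by (cases \<phi>) auto

text \<open>The subformulas met in the induction are not sentences, so the case without a binder has
  to be kept: then \<open>v\<close> stays free all the way up. For a sentence the root refutes this
  case.\<close>

lemma binding_index_cases:
  assumes "subformula \<psi> i = Some \<phi>" "v \<in> free \<phi>"
  shows "(binding_index \<psi> i v = None \<and> (\<forall>k. prefix k i \<longrightarrow> v \<in> free (sub_at \<psi> k))) \<or>
    (\<exists>j. binding_index \<psi> i v = Some j \<and> located \<psi> (j, v) \<and> index_follows \<psi> i (j, v))"
  using assms
proof (induction i arbitrary: \<psi>)
  case Nil
  then show ?case by simp
next
  case (Cons b i)
  let ?\<chi> = "child_formula \<psi> b"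
  have s: "subformula \<psi> (b # k) = subformula ?\<chi> k" for k
    using subformula_child[of \<psi> b i] Cons.prems by simp
  have ind: "b # k \<in> indices \<psi> \<longleftrightarrow> k \<in> indices ?\<chi>" for k
    by (simp add: indices_def s)
  have bi: "b # i \<in> indices \<psi>"
    using Cons.prems by (simp add: indices_def)
  from Cons.IH[of ?\<chi>] Cons.prems s consider
    (none) "binding_index ?\<chi> i v = None" "\<forall>k. prefix k i \<longrightarrow> v \<in> free (sub_at ?\<chi> k)"
  | (some) j where "binding_index ?\<chi> i v = Some j" "located ?\<chi> (j, v)" "index_follows ?\<chi> i (j, v)"
    by auto
  then show ?case
  proof cases
    case none
    have k: "v \<in> free (sub_at \<psi> k)" if "prefix k (b # i)" "k \<noteq> []" for k
      using that none s by (cases k) auto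
    show ?thesis
    proof (cases "quantifies \<psi> v")
      case True
      then show ?thesis
        using none k bi by (auto simp: located_iff index_follows_def indices_def strict_prefix_def)
    next
      case False
      have "v \<in> free ?\<chi>"
        using none(2) by (metis Nil_prefix option.sel subformula.simps(1))
      then have "v \<in> free \<psi>"
        using free_child False by blast
      then show ?thesis
        using none k False by (auto simp: prefix_Cons)
    qed
  next
    case some
    have "v \<in> free (sub_at \<psi> k)" if "strict_prefix (b # j) k" "prefix k (b # i)" for k
      using that some s by (cases k) (auto simp: index_follows_def)
    then show ?thesis
      using some ind s bi by (auto simp: located_iff index_follows_def)
  qed
qed

lemma binding_index_follows:
  assumes "free \<psi> = {}" "i \<in> indices \<psi>" "v \<in> free (sub_at \<psi> i)"
  obtains j where "binding_index \<psi> i v = Some j" "located \<psi> (j, v)" "index_follows \<psi> i (j, v)"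
proof -
  obtain \<phi> where "subformula \<psi> i = Some \<phi>"
    using assms by (auto simp: indices_def)
  moreover have "\<not> (\<forall>k. prefix k i \<longrightarrow> v \<in> free (sub_at \<psi> k))"
    using assms(1) by (metis Nil_prefix empty_iff option.sel subformula.simps(1))
  ultimately show thesis
    using binding_index_cases[of \<psi> i \<phi> v] assms(3) that by auto
qed

text \<open>Both \<open>j\<close> and \<open>k\<close> are prefixes of \<open>i\<close>, hence
  comparable. Were \<open>k\<close> strictly above \<open>j\<close>, following \<open>(k, v)\<close>
  would require \<open>v\<close> to be free at \<open>j\<close>, where it is quantified.\<close>

lemma follows_unique:
  assumes "located \<psi> (j, v)" "index_follows \<psi> i (j, v)"
    and "located \<psi> (k, v)" "index_follows \<psi> i (k, v)"
  shows "j = k"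
proof -
  have "\<not> strict_prefix k j"
    if "located \<psi> (j, v)" "index_follows \<psi> i (j, v)" "index_follows \<psi> i (k, v)" for j k
    using that quantifies_not_free
    by (auto simp: located_iff index_follows_def strict_prefix_def)
  moreover have "prefix j k \<or> prefix k j"
    using assms prefix_same_cases[of j i k] by (auto simp: index_follows_def strict_prefix_def)
  ultimately show ?thesis
    using assms by (auto simp: strict_prefix_def)
qed

lemma binding_index_eqI:
  assumes "free \<psi> = {}" "located \<psi> (j, v)" "index_follows \<psi> i (j, v)"
  shows "binding_index \<psi> i v = Some j"
proof -
  have "i \<in> indices \<psi>" "v \<in> free (sub_at \<psi> i)"
    using assms by (auto simp: index_follows_def)
  from binding_index_follows[OF assms(1) this] show ?thesis
    using follows_unique assms by metis
qed

text \<open>The path to \<open>j\<close> has only \<open>j\<close> itself in addition, and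
  \<open>v\<close> is free there; so the binder followed by \<open>i\<close> is followed by
  \<open>j\<close> too, and binders are unique. This is why flow in either direction preserves
  labels.\<close>

lemma binding_index_parent:
  assumes "free \<psi> = {}" "is_parent \<psi> i j" "v \<in> free (sub_at \<psi> i)" "v \<in> free (sub_at \<psi> j)"
  shows "binding_index \<psi> j v = binding_index \<psi> i v"
proof -
  from assms(2) obtain b where b: "j = i @ [b]" "i \<in> indices \<psi>" "j \<in> indices \<psi>"
    by (auto simp: is_parent_def)
  obtain k where k: "binding_index \<psi> i v = Some k" "located \<psi> (k, v)" "index_follows \<psi> i (k, v)"
    using binding_index_follows assms(1,3) b(2) by metis
  have "index_follows \<psi> j (k, v)"
    using k(3) b assms(4) by (auto simp: index_follows_def prefix_snoc strict_prefix_def)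
  then show ?thesis
    using binding_index_eqI assms(1) k by simp
qed

lemma binding_index_quantifier:
  assumes "free \<psi> = {}" "is_parent \<psi> i j" "quantifies (sub_at \<psi> i) v" "v \<in> free (sub_at \<psi> j)"
  shows "binding_index \<psi> j v = Some i"
proof -
  from assms(2) obtain b where b: "j = i @ [b]" "i \<in> indices \<psi>" "j \<in> indices \<psi>"
    by (auto simp: is_parent_def)
  have "index_follows \<psi> j (i, v)"
    using b assms(4)
    by (auto simp: index_follows_def prefix_snoc strict_prefix_def dest: prefix_order.antisym)
  then show ?thesis
    using binding_index_eqI assms b by (simp add: located_iff)
qed


section \<open>Translation of proofs into traces\<close>

definition located_vars :: "qcbf \<Rightarrow> index \<Rightarrow> nat set \<Rightarrow> located_var set" where
  "located_vars \<psi> i V = (\<lambda>v. (the (binding_index \<psi> i v), v)) ` V"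

text \<open>The preference for \<open>Pos\<close> is invisible on clauses, which contain no
  complementary literals.\<close>

definition falsifier :: "clause \<Rightarrow> nat \<rightharpoonup> bool" where
  "falsifier \<alpha> v = (if Pos v \<in> \<alpha> then Some False else if Neg v \<in> \<alpha> then Some True else None)"

definition label_of :: "qcbf \<Rightarrow> judgement \<Rightarrow> trace_label" where
  "label_of \<psi> J = (located_vars \<psi> (fst J) (vars_clause (snd J)), falsifier (snd J))"

text \<open>
  A judgement with a single predecessor has a clause contained in that of the predecessor, so
  comparing cardinalities tells the flow steps from the proper removals.
\<close>

fun trace_of :: "qcbf \<Rightarrow> judgement rtree \<Rightarrow> trace_label rtree" where
  "trace_of \<psi> (RNode J []) = RNode (label_of \<psi> J) []"
| "trace_of \<psi> (RNode J [t]) =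
     (if card (snd J) = card (snd (root_label t)) then trace_of \<psi> t
      else RNode (label_of \<psi> J) [trace_of \<psi> t])"
| "trace_of \<psi> (RNode J (s # t # ts)) = RNode (label_of \<psi> J) [trace_of \<psi> s, trace_of \<psi> t]"

text \<open>Positions in the proof list are forgotten; local correctness of every inference is what
  an induction over the tree requires.\<close>

inductive proof_tree :: "qcbf \<Rightarrow> judgement rtree \<Rightarrow> bool" for \<psi> where
  node: "\<lbrakk> clause_judgement \<psi> J; \<forall>t\<in>set ts. proof_tree \<psi> t;
     by_clause \<psi> (map root_label ts) J \<or> by_resolve \<psi> (map root_label ts) J \<or>
     by_upward_flow \<psi> (map root_label ts) J \<or> by_all_removal \<psi> (map root_label ts) J \<or>
     by_downward_flow \<psi> (map root_label ts) J \<rbrakk>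
   \<Longrightarrow> proof_tree \<psi> (RNode J ts)"

lemma proof_tree_induced:
  assumes "is_cj_proof \<psi> \<Pi>" "k < length \<Pi>"
  shows "proof_tree \<psi> (induced_tree \<Pi> k)"
  using assms(2)
proof (induction k rule: less_induct)
  case (less k)
  have step: "clause_judgement \<psi> (judgement_at \<Pi> k)" "\<forall>p\<in>set (preds_at \<Pi> k). p < k"
    "let J = judgement_at \<Pi> k; Js = map (judgement_at \<Pi>) (preds_at \<Pi> k) in
       by_clause \<psi> Js J \<or> by_resolve \<psi> Js J \<or> by_upward_flow \<psi> Js J \<or>
       by_all_removal \<psi> Js J \<or> by_downward_flow \<psi> Js J"
    using assms(1) less.prems unfolding is_cj_proof_def Let_def by auto
  have flt: "filter (\<lambda>p. p < k) (preds_at \<Pi> k) = preds_at \<Pi> k"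
    using step(2) by simp
  have rl: "root_label (induced_tree \<Pi> p) = judgement_at \<Pi> p" for p
    by (subst induced_tree.simps) simp
  have rls: "map root_label (map (induced_tree \<Pi>) (preds_at \<Pi> k)) =
      map (judgement_at \<Pi>) (preds_at \<Pi> k)"
    by (simp add: rl)
  show ?case
    unfolding induced_tree.simps[of \<Pi> k] flt
  proof (rule proof_tree.node)
    show "\<forall>t\<in>set (map (induced_tree \<Pi>) (preds_at \<Pi> k)). proof_tree \<psi> t"
      using less step(2) by fastforce
  qed (use step(1,3) in \<open>unfold rls Let_def, blast+\<close>)
qed

section \<open>Well-formedness of the labels of judgements\<close>

lemma vars_clause_iff: "v \<in> vars_clause \<alpha> \<longleftrightarrow> Pos v \<in> \<alpha> \<or> Neg v \<in> \<alpha>"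
proof -
  have v: "v = var_of L \<longleftrightarrow> L = Pos v \<or> L = Neg v" for L
    by (cases L) auto
  show ?thesis
    unfolding vars_clause_def image_iff v by blast
qed

lemma dom_falsifier: "dom (falsifier \<alpha>) = vars_clause \<alpha>"
  by (auto simp: falsifier_def vars_clause_iff split: if_splits)

lemma falsified_falsifier:
  assumes "is_clause \<alpha>"
  shows "falsified \<alpha> (falsifier \<alpha>)"
proof -
  have "literal_false (falsifier \<alpha>) L" if "L \<in> \<alpha>" for L
    using that assms by (cases L) (auto simp: falsifier_def is_clause_def)
  then show ?thesis
    by (simp add: falsified_def dom_falsifier)
qed

lemma vars_located_vars [simp]: "vars_located (located_vars \<psi> i V) = V"
  by (force simp: vars_located_def located_vars_def)

lemma located_vars_follows:
  assumes "free \<psi> = {}" "i \<in> indices \<psi>" "V \<subseteq> free (sub_at \<psi> i)" "x \<in> located_vars \<psi> i V"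
  shows "located \<psi> x" "index_follows \<psi> i x"
proof -
  obtain v where v: "v \<in> V" "x = (the (binding_index \<psi> i v), v)"
    using assms(4) by (auto simp: located_vars_def)
  have "v \<in> free (sub_at \<psi> i)"
    using v assms(3) by auto
  from binding_index_follows[OF assms(1,2) this] show "located \<psi> x" "index_follows \<psi> i x"
    using v(2) by (metis option.sel)+
qed

text \<open>Two located variables followed by a common index lie on a single branch.\<close>

lemma coherent_located_vars:
  assumes "free \<psi> = {}" "i \<in> indices \<psi>" "V \<subseteq> free (sub_at \<psi> i)"
  shows "coherent \<psi> (located_vars \<psi> i V)"
  unfolding coherent_def
proof (intro ballI impI)
  fix x y
  assume xy: "x \<in> located_vars \<psi> i V" "y \<in> located_vars \<psi> i V" "x \<noteq> y"
  note x = located_vars_follows[OF assms xy(1)] and y = located_vars_follows[OF assms xy(2)]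
  have ne: "fst x \<noteq> fst y"
    using x(1) y(1) xy(3) by (cases x; cases y) (auto simp: located_def)
  have "follows \<psi> x y" if "prefix (fst y) (fst x)" "index_follows \<psi> i x" "index_follows \<psi> i y"
    "fst x \<noteq> fst y" for x y
    using that indices_prefix
    by (cases x; cases y) (auto simp: follows_def index_follows_def strict_prefix_def
        intro: prefix_order.trans)
  moreover have "prefix (fst x) (fst y) \<or> prefix (fst y) (fst x)"
    using x y prefix_same_cases[of "fst x" i "fst y"]
    by (cases x; cases y) (auto simp: index_follows_def strict_prefix_def)
  ultimately show "follows \<psi> x y \<or> follows \<psi> y x"
    using x y ne by metis
qed

lemma wf_label_of:
  assumes "free \<psi> = {}" "clause_judgement \<psi> (i, \<alpha>)"
  shows "wf_label \<psi> (located_vars \<psi> i (vars_clause \<alpha>), falsifier \<alpha>)"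
proof -
  have i: "i \<in> indices \<psi>" "vars_clause \<alpha> \<subseteq> free (sub_at \<psi> i)"
    using assms(2) by (auto simp: clause_judgement_def)
  show ?thesis
    using located_vars_follows(1)[OF assms(1) i] coherent_located_vars[OF assms(1) i]
    by (simp add: wf_label_def dom_falsifier)
qed

lemma located_vars_parent:
  assumes "free \<psi> = {}" "is_parent \<psi> i j" "V \<subseteq> free (sub_at \<psi> i)" "V \<subseteq> free (sub_at \<psi> j)"
  shows "located_vars \<psi> j V = located_vars \<psi> i V"
  using binding_index_parent[OF assms(1,2)] assms(3,4) by (force simp: located_vars_def)

lemma located_vars_Un: "located_vars \<psi> i (V \<union> W) = located_vars \<psi> i V \<union> located_vars \<psi> i W"
  by (auto simp: located_vars_def)

lemma located_vars_mono: "V \<subseteq> W \<Longrightarrow> located_vars \<psi> i V \<subseteq> located_vars \<psi> i W"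
  by (auto simp: located_vars_def)

text \<open>Gives the assignment of a resolution premise the shape that a trace demands of a child.
  On the remaining variables \<open>\<alpha>\<close> and \<open>\<gamma>\<close> share their
  literals, and the new value makes \<open>L\<close> false.\<close>

lemma falsifier_insert:
  assumes "is_clause \<alpha>" "\<alpha> - {L} \<subseteq> \<gamma>" "is_clause \<gamma>" "L \<in> \<alpha>"
  shows "falsifier \<alpha> =
    (falsifier \<gamma> |` vars_clause (\<alpha> - {L}))(var_of L \<mapsto> (case L of Pos _ \<Rightarrow> False | Neg _ \<Rightarrow> True))"
proof
  fix v
  show "falsifier \<alpha> v = ((falsifier \<gamma> |` vars_clause (\<alpha> - {L}))
    (var_of L \<mapsto> (case L of Pos _ \<Rightarrow> False | Neg _ \<Rightarrow> True))) v"
    using assms by (cases L) (auto simp: falsifier_def restrict_map_def vars_clause_iff is_clause_def)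
qed


section \<open>Inferences as trace nodes\<close>

lemma clause_judgementD:
  assumes "clause_judgement \<psi> (i, \<alpha>)"
  shows "i \<in> indices \<psi>" "is_clause \<alpha>" "vars_clause \<alpha> \<subseteq> free (sub_at \<psi> i)"
  using assms by (auto simp: clause_judgement_def)

lemma trace_resolve:
  assumes free: "free \<psi> = {}"
    and cj: "clause_judgement \<psi> (i, \<alpha>)" "clause_judgement \<psi> (i, \<beta>)" "clause_judgement \<psi> (i, \<gamma>)"
    and res: "is_resolvent \<gamma> \<alpha> \<beta>"
    and s: "is_trace \<psi> s" "root_label s = label_of \<psi> (i, \<alpha>)"
    and t: "is_trace \<psi> t" "root_label t = label_of \<psi> (i, \<beta>)"
  shows "is_trace \<psi> (RNode (label_of \<psi> (i, \<gamma>)) [s, t])"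
proof -
  from res obtain L where L: "L \<in> \<alpha>" "complement L \<in> \<beta>"
    and \<gamma>: "\<gamma> = (\<alpha> - {L}) \<union> (\<beta> - {complement L})"
    by (auto simp: is_resolvent_def)
  note \<alpha>D = clause_judgementD[OF cj(1)] and \<beta>D = clause_judgementD[OF cj(2)]
    and \<gamma>D = clause_judgementD[OF cj(3)]
  define u where "u = var_of L"
  let ?M = "complement L"
  let ?U = "located_vars \<psi> i"
  have uM: "var_of ?M = u"
    by (cases L) (auto simp: u_def)
  have ins: "vars_clause \<delta> = vars_clause (\<delta> - {K}) \<union> {var_of K}" if "K \<in> \<delta>" for K \<delta>
    using that by (auto simp: vars_clause_def)
  have v\<alpha>: "vars_clause \<alpha> = vars_clause (\<alpha> - {L}) \<union> {u}"
    using ins[OF L(1)] by (simp add: u_def)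
  have v\<beta>: "vars_clause \<beta> = vars_clause (\<beta> - {?M}) \<union> {u}"
    using ins[OF L(2)] by (simp add: uM)
  have v\<gamma>: "vars_clause \<gamma> = vars_clause (\<alpha> - {L}) \<union> vars_clause (\<beta> - {?M})"
    by (simp add: \<gamma> vars_clause_def image_Un)
  \<comment> \<open>Each premise has only one literal on \<open>u\<close>, and that literal is
    removed.\<close>
  have "u \<notin> vars_clause \<gamma>"
    using \<alpha>D(2) \<beta>D(2) L unfolding vars_clause_iff \<gamma> u_def is_clause_def by (cases L) auto
  then have notin: "(the (binding_index \<psi> i u), u) \<notin> ?U (vars_clause \<gamma>)"
    by (auto simp: located_vars_def)
  have U1: "?U {u} = {(the (binding_index \<psi> i u), u)}"
    by (simp add: located_vars_def)
  have uf: "{u} \<subseteq> free (sub_at \<psi> i)"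
    using \<alpha>D(3) v\<alpha> by auto
  have loc: "located \<psi> (the (binding_index \<psi> i u), u)"
    using located_vars_follows(1)[OF free \<alpha>D(1) uf] U1 by auto
  \<comment> \<open>Adding the binder of \<open>u\<close> again gives a set of binders of variables
    free at \<open>i\<close>, so the general coherence result applies.\<close>
  have coh: "coherent \<psi> (?U (vars_clause \<gamma>) \<union> {(the (binding_index \<psi> i u), u)})"
    unfolding U1[symmetric] located_vars_Un[symmetric]
    by (rule coherent_located_vars[OF free \<alpha>D(1)]) (use uf \<gamma>D(3) in auto)
  note wf = wf_label_of[OF free cj(3)]
  have s0: "root_label s = (?U (vars_clause (\<alpha> - {L})) \<union> {(the (binding_index \<psi> i u), u)},
      (falsifier \<gamma> |` vars_located (?U (vars_clause (\<alpha> - {L}))))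
        (u \<mapsto> (case L of Pos _ \<Rightarrow> False | Neg _ \<Rightarrow> True)))"
    using falsifier_insert[OF \<alpha>D(2) _ \<gamma>D(2) L(1)]
    by (simp add: s(2) label_of_def v\<alpha> located_vars_Un U1 u_def[symmetric] \<gamma> del: Un_insert_right)
  have t0: "root_label t = (?U (vars_clause (\<beta> - {?M})) \<union> {(the (binding_index \<psi> i u), u)},
      (falsifier \<gamma> |` vars_located (?U (vars_clause (\<beta> - {?M}))))
        (u \<mapsto> (case ?M of Pos _ \<Rightarrow> False | Neg _ \<Rightarrow> True)))"
    using falsifier_insert[OF \<beta>D(2) _ \<gamma>D(2) L(2)]
    by (simp add: t(2) label_of_def v\<beta> located_vars_Un U1 uM \<gamma> del: Un_insert_right)
  note sub = located_vars_mono[of "vars_clause (\<alpha> - {L})" "vars_clause \<gamma>" \<psi> i]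
    located_vars_mono[of "vars_clause (\<beta> - {?M})" "vars_clause \<gamma>" \<psi> i]
  have un: "?U (vars_clause (\<alpha> - {L})) \<union> ?U (vars_clause (\<beta> - {?M})) = ?U (vars_clause \<gamma>)"
    by (simp add: v\<gamma> located_vars_Un)
  show ?thesis
  \<comment> \<open>The premise with the positive literal must be the child for the value false. The
    list \<open>[s, t]\<close> keeps the order of the proof, so for a negative \<open>L\<close> the
    two roles are exchanged.\<close>
  proof (cases L)
    case (Pos w)
    show ?thesis
      unfolding label_of_def fst_conv snd_conv
      by (rule two_children[OF wf loc notin coh _ _ un s(1) _ t(1)])
        (use s0 t0 sub v\<gamma> Pos in auto)
  next
    case (Neg w)
    show ?thesis
      unfolding label_of_def fst_conv snd_conv
      by (rule two_children[OF wf loc notin coh _ _ un[unfolded Un_commute[of "?U (vars_clause (\<alpha> - {L}))"]] t(1) _ s(1)])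
        (use s0 t0 sub v\<gamma> Neg in auto)
  qed
qed

text \<open>At \<open>j\<close> the variable \<open>y\<close> is bound by \<open>i\<close> itself,
  while the other variables have the same binders at \<open>i\<close> and \<open>j\<close>. As
  \<open>i\<close> follows all of these, so does \<open>(i, y)\<close>.\<close>

lemma trace_all_removal:
  assumes free: "free \<psi> = {}"
    and cj: "clause_judgement \<psi> (i, \<alpha> - {Pos y, Neg y})" "clause_judgement \<psi> (j, \<alpha>)"
    and par: "is_parent \<psi> i j" and all: "sub_at \<psi> i = QAll y (sub_at \<psi> j)"
    and y: "y \<in> vars_clause \<alpha>"
    and t: "is_trace \<psi> t" "root_label t = label_of \<psi> (j, \<alpha>)"
  shows "is_trace \<psi> (RNode (label_of \<psi> (i, \<alpha> - {Pos y, Neg y})) [t])"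
proof -
  let ?\<beta> = "\<alpha> - {Pos y, Neg y}"
  note \<beta>D = clause_judgementD[OF cj(1)] and \<alpha>D = clause_judgementD[OF cj(2)]
  have v: "vars_clause \<alpha> = vars_clause ?\<beta> \<union> {y}"
    using y by (auto simp: vars_clause_iff)
  have "binding_index \<psi> j y = Some i"
    using binding_index_quantifier[OF free par, of y] all y \<alpha>D(3) by auto
  moreover have "located_vars \<psi> j (vars_clause ?\<beta>) = located_vars \<psi> i (vars_clause ?\<beta>)"
    by (rule located_vars_parent[OF free par \<beta>D(3)]) (use \<alpha>D(3) v in auto)
  ultimately have S: "located_vars \<psi> j (vars_clause \<alpha>) = located_vars \<psi> i (vars_clause ?\<beta>) \<union> {(i, y)}"
    unfolding v located_vars_Un by (simp add: located_vars_def)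
  have a: "falsifier \<alpha> = (falsifier ?\<beta>)(y \<mapsto> Pos y \<notin> \<alpha>)"
    using y by (auto simp: fun_eq_iff falsifier_def vars_clause_iff)
  show ?thesis
    unfolding label_of_def fst_conv snd_conv
  proof (rule one_child[OF wf_label_of[OF free cj(1)] _ _ t(1)])
    show "forall_located \<psi> (i, y)"
      using all \<beta>D(1) by (simp add: forall_located_def)
    show "follows_set \<psi> (i, y) (located_vars \<psi> i (vars_clause ?\<beta>))"
      using located_vars_follows(2)[OF free \<beta>D(1,3)] by (simp add: follows_set_def follows_def)
    show "root_label t = (located_vars \<psi> i (vars_clause ?\<beta>) \<union> {(i, y)},
        (falsifier ?\<beta>)(y \<mapsto> Pos y \<notin> \<alpha>))"
      by (simp add: t(2) label_of_def S a)
  qed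
qed

lemma proof_tree_root: "proof_tree \<psi> P \<Longrightarrow> clause_judgement \<psi> (root_label P)"
  by (cases rule: proof_tree.cases) auto

text \<open>The root label is part of the induction because the trace rules prescribe the labels of
  the children.\<close>

lemma trace_of_correct:
  assumes "free \<psi> = {}" "proof_tree \<psi> P"
  shows "is_trace \<psi> (trace_of \<psi> P) \<and> root_label (trace_of \<psi> P) = label_of \<psi> (root_label P) \<and>
    num_nodes (trace_of \<psi> P) = num_nonflow \<psi> P"
  using assms(2)
proof (induction P rule: proof_tree.induct)
  case (node J ts)
  obtain i \<alpha> where J: "J = (i, \<alpha>)"
    by fastforce
  note D = clause_judgementD[OF node.hyps(1)[unfolded J]]
  have cjs: "clause_judgement \<psi> (root_label t)" if "t \<in> set ts" for t
    using node.IH that proof_tree_root by blast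
  \<comment> \<open>Serves both flow directions and also the removal of an absent variable, which
    leaves the clause unchanged and so counts as an upward flow.\<close>
  have flow: ?case if ts: "ts = [t]" and t: "root_label t = (j, \<alpha>)"
    and par: "is_parent \<psi> i j \<or> is_parent \<psi> j i" for t j
  proof -
    note D' = clause_judgementD[OF cjs[of t, unfolded t]]
    have "located_vars \<psi> j (vars_clause \<alpha>) = located_vars \<psi> i (vars_clause \<alpha>)"
      using par located_vars_parent[OF assms(1) _ D(3)] located_vars_parent[OF assms(1), of j i]
        D(3) D'(3) ts by auto
    moreover have "by_upward_flow \<psi> [(j, \<alpha>)] J \<or> by_downward_flow \<psi> [(j, \<alpha>)] J"
      using par by (auto simp: by_upward_flow_def by_downward_flow_def J)
    ultimately show ?thesis
      using node.IH by (simp add: ts t J label_of_def)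
  qed
  from node.hyps(2) consider
      (cl) "by_clause \<psi> (map root_label ts) J"
    | (res) "by_resolve \<psi> (map root_label ts) J"
    | (up) "by_upward_flow \<psi> (map root_label ts) J"
    | (rem) "by_all_removal \<psi> (map root_label ts) J"
    | (down) "by_downward_flow \<psi> (map root_label ts) J"
    by blast
  then show ?case
  proof cases
    case cl
    then have ts: "ts = []" and i: "sub_at \<psi> i = Cl \<alpha>"
      by (auto simp: by_clause_def J)
    have "is_trace \<psi> (RNode (label_of \<psi> (i, \<alpha>)) [])"
      unfolding label_of_def fst_conv snd_conv
      by (rule no_child[OF wf_label_of[OF assms(1) node.hyps(1)[unfolded J]] D(1) _ i falsified_falsifier[OF D(2)]])
        (use located_vars_follows(2)[OF assms(1) D(1,3)] in \<open>auto simp: index_follows_set_def\<close>)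
    then show ?thesis
      by (simp add: ts J by_upward_flow_def by_downward_flow_def)
  next
    case res
    then obtain s t \<beta> \<gamma> where ts: "ts = [s, t]" and st: "root_label s = (i, \<beta>)" "root_label t = (i, \<gamma>)"
      and r: "is_resolvent \<alpha> \<beta> \<gamma>"
      by (auto simp: by_resolve_def J)
    have "is_trace \<psi> (RNode (label_of \<psi> (i, \<alpha>)) [trace_of \<psi> s, trace_of \<psi> t])"
      by (rule trace_resolve[OF assms(1) _ _ _ r])
        (use cjs[of s] cjs[of t] node.IH node.hyps(1) ts st J in auto)
    then show ?thesis
      using node.IH by (simp add: ts J by_upward_flow_def by_downward_flow_def)
  next
    case up
    then show ?thesis
      using flow by (auto simp: by_upward_flow_def J)
  next
    case down
    then show ?thesis
      using flow by (auto simp: by_downward_flow_def J)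
  next
    case rem
    then obtain t j \<beta> y where ts: "ts = [t]" and t: "root_label t = (j, \<beta>)"
      and \<alpha>: "\<alpha> = \<beta> - {Pos y, Neg y}" and par: "is_parent \<psi> i j"
      and all: "sub_at \<psi> i = QAll y (sub_at \<psi> j)"
      by (auto simp: by_all_removal_def J)
    have cj: "clause_judgement \<psi> (j, \<beta>)"
      using cjs[of t] ts t by simp
    show ?thesis
    proof (cases "y \<in> vars_clause \<beta>")
      case False
      then have "\<alpha> = \<beta>"
        using \<alpha> by (auto simp: vars_clause_iff)
      then show ?thesis
        using flow ts t par by simp
    next
      case True
      \<comment> \<open>Strict inclusion is used twice: the cardinalities differ, so
        \<open>trace_of\<close> creates a node, and the clauses differ, so the step is not counted
        as a flow.\<close>
      then have ne: "\<alpha> \<subset> \<beta>"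
        using \<alpha> by (auto simp: vars_clause_iff)
      then have "card \<alpha> < card \<beta>"
        using clause_judgementD(2)[OF cj] by (simp add: is_clause_def psubset_card_mono)
      moreover have "is_trace \<psi> (RNode (label_of \<psi> (i, \<alpha>)) [trace_of \<psi> t])"
        unfolding \<alpha>
        by (rule trace_all_removal[OF assms(1) _ cj par all True])
          (use node.IH node.hyps(1) ts t J \<alpha> in auto)
      ultimately show ?thesis
        using node.IH ne by (auto simp: ts t J by_upward_flow_def by_downward_flow_def)
    qed
  qed
qed


section \<open>Symbolic execution of programs\<close>

text \<open>
  Evaluation of an expression relative to presumed values \<open>F f ws\<close> and time bounds \<open>G f ws\<close> of the
  called functions.  By simplification, this turns a concrete function body into its value,
  its running time and the calls it depends on.
\<close>

fun exp_value :: "(nat \<Rightarrow> sexp list \<Rightarrow> sexp) \<Rightarrow> sexp list \<Rightarrow> exp \<Rightarrow> sexp" where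
  "exp_value F vs (ArgE n) = vs ! n"
| "exp_value F vs NlE = Nl"
| "exp_value F vs (PrE e1 e2) = Pr (exp_value F vs e1) (exp_value F vs e2)"
| "exp_value F vs (FstE e) = sexp_fst (exp_value F vs e)"
| "exp_value F vs (SndE e) = sexp_snd (exp_value F vs e)"
| "exp_value F vs (IfE e e1 e2) =
     (if exp_value F vs e = Nl then exp_value F vs e2 else exp_value F vs e1)"
| "exp_value F vs (CallE f es) = F f (map (exp_value F vs) es)"

fun exp_time ::
  "(nat \<Rightarrow> sexp list \<Rightarrow> sexp) \<Rightarrow> (nat \<Rightarrow> sexp list \<Rightarrow> nat) \<Rightarrow> sexp list \<Rightarrow> exp \<Rightarrow> nat" where
  "exp_time F G vs (ArgE n) = sexp_size (vs ! n)"
| "exp_time F G vs NlE = 1"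
| "exp_time F G vs (PrE e1 e2) =
     exp_time F G vs e1 + exp_time F G vs e2 + sexp_size (exp_value F vs (PrE e1 e2))"
| "exp_time F G vs (FstE e) = exp_time F G vs e + sexp_size (exp_value F vs (FstE e))"
| "exp_time F G vs (SndE e) = exp_time F G vs e + sexp_size (exp_value F vs (SndE e))"
| "exp_time F G vs (IfE e e1 e2) =
     exp_time F G vs e +
     (if exp_value F vs e = Nl then exp_time F G vs e2 else exp_time F G vs e1) +
     sexp_size (exp_value F vs (IfE e e1 e2))"
| "exp_time F G vs (CallE f es) =
     sum_list (map (exp_time F G vs) es) + G f (map (exp_value F vs) es) +
     sexp_size (exp_value F vs (CallE f es))"

text \<open>Hiding the exact time behind a bound lets the induction hypothesis on a recursive call
  be used directly when its caller is bounded.\<close>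

definition computes ::
  "program \<Rightarrow> (nat \<Rightarrow> sexp list \<Rightarrow> sexp) \<Rightarrow> (nat \<Rightarrow> sexp list \<Rightarrow> nat) \<Rightarrow> nat \<Rightarrow> sexp list \<Rightarrow> bool" where
  "computes p F G f ws \<longleftrightarrow> f < length p \<and> (\<exists>t. eval p ws (p ! f) (F f ws) t \<and> t \<le> G f ws)"

text \<open>Only the branch actually taken is examined: the other one may contain a recursive call
  on arguments about which no hypothesis is available.\<close>

fun calls_ok ::
  "program \<Rightarrow> (nat \<Rightarrow> sexp list \<Rightarrow> sexp) \<Rightarrow> (nat \<Rightarrow> sexp list \<Rightarrow> nat) \<Rightarrow> sexp list \<Rightarrow> exp \<Rightarrow> bool" where
  "calls_ok p F G vs (ArgE n) \<longleftrightarrow> n < length vs"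
| "calls_ok p F G vs NlE \<longleftrightarrow> True"
| "calls_ok p F G vs (PrE e1 e2) \<longleftrightarrow> calls_ok p F G vs e1 \<and> calls_ok p F G vs e2"
| "calls_ok p F G vs (FstE e) \<longleftrightarrow> calls_ok p F G vs e"
| "calls_ok p F G vs (SndE e) \<longleftrightarrow> calls_ok p F G vs e"
| "calls_ok p F G vs (IfE e e1 e2) \<longleftrightarrow>
     calls_ok p F G vs e \<and>
     (if exp_value F vs e = Nl then calls_ok p F G vs e2 else calls_ok p F G vs e1)"
| "calls_ok p F G vs (CallE f es) \<longleftrightarrow>
     list_all (calls_ok p F G vs) es \<and> computes p F G f (map (exp_value F vs) es)"

lemma evals_list:
  assumes "\<And>e. e \<in> set es \<Longrightarrow> \<exists>t. eval p vs e (g e) t \<and> t \<le> h e"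
  shows "\<exists>t. evals p vs es (map g es) t \<and> t \<le> sum_list (map h es)"
  using assms
proof (induction es)
  case Nil
  show ?case
    using evals_Nil[of p vs] by auto
next
  case (Cons e es)
  obtain t where t: "eval p vs e (g e) t" "t \<le> h e"
    using Cons.prems[of e] by auto
  obtain t' where t': "evals p vs es (map g es) t'" "t' \<le> sum_list (map h es)"
    using Cons.IH Cons.prems by (meson list.set_intros(2))
  show ?case
    unfolding list.map by (intro exI conjI, rule evals_Cons[OF t(1) t'(1)]) (use t(2) t'(2) in simp)
qed

lemma eval_exp_value:
  assumes "calls_ok p F G vs e"
  shows "\<exists>t. eval p vs e (exp_value F vs e) t \<and> t \<le> exp_time F G vs e"
  using assms
proof (induction e)
  case (ArgE n)
  then show ?case
    using eval_ArgE[of n vs p] by auto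
next
  case NlE
  show ?case
    using eval_NlE[of p vs] by auto
next
  case (PrE e1 e2)
  obtain t1 where t1: "eval p vs e1 (exp_value F vs e1) t1" "t1 \<le> exp_time F G vs e1"
    using PrE.IH(1) PrE.prems by auto
  obtain t2 where t2: "eval p vs e2 (exp_value F vs e2) t2" "t2 \<le> exp_time F G vs e2"
    using PrE.IH(2) PrE.prems by auto
  show ?case
    unfolding exp_value.simps
    by (intro exI conjI, rule eval_PrE[OF t1(1) t2(1)]) (use t1(2) t2(2) in simp)
next
  case (FstE e)
  obtain t where t: "eval p vs e (exp_value F vs e) t" "t \<le> exp_time F G vs e"
    using FstE.IH FstE.prems by auto
  show ?case
    unfolding exp_value.simps by (intro exI conjI, rule eval_FstE[OF t(1)]) (use t(2) in simp)
next
  case (SndE e)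
  obtain t where t: "eval p vs e (exp_value F vs e) t" "t \<le> exp_time F G vs e"
    using SndE.IH SndE.prems by auto
  show ?case
    unfolding exp_value.simps by (intro exI conjI, rule eval_SndE[OF t(1)]) (use t(2) in simp)
next
  case (IfE e e1 e2)
  obtain t where t: "eval p vs e (exp_value F vs e) t" "t \<le> exp_time F G vs e"
    using IfE.IH(1) IfE.prems by auto
  show ?case
  proof (cases "exp_value F vs e = Nl")
    case True
    obtain t2 where t2: "eval p vs e2 (exp_value F vs e2) t2" "t2 \<le> exp_time F G vs e2"
      using IfE.IH(3) IfE.prems True by auto
    have "eval p vs (IfE e e1 e2) (exp_value F vs (IfE e e1 e2))
        (t + t2 + sexp_size (exp_value F vs e2))"
      using eval_IfE_false[OF t(1)[unfolded True] t2(1)] True by simp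
    then show ?thesis
      by (intro exI conjI, assumption) (use t(2) t2(2) True in simp)
  next
    case False
    obtain t1 where t1: "eval p vs e1 (exp_value F vs e1) t1" "t1 \<le> exp_time F G vs e1"
      using IfE.IH(2) IfE.prems False by auto
    have "eval p vs (IfE e e1 e2) (exp_value F vs (IfE e e1 e2))
        (t + t1 + sexp_size (exp_value F vs e1))"
      using eval_IfE_true[OF t(1) False t1(1)] False by simp
    then show ?thesis
      by (intro exI conjI, assumption) (use t(2) t1(2) False in simp)
  qed
next
  case (CallE f es)
  have "\<exists>t. evals p vs es (map (exp_value F vs) es) t \<and> t \<le> sum_list (map (exp_time F G vs) es)"
    by (rule evals_list) (use CallE.IH CallE.prems in \<open>simp add: list_all_iff\<close>)
  then obtain t where t: "evals p vs es (map (exp_value F vs) es) t"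
    "t \<le> sum_list (map (exp_time F G vs) es)"
    by blast
  let ?ws = "map (exp_value F vs) es"
  obtain t' where t': "f < length p" "eval p ?ws (p ! f) (F f ?ws) t'" "t' \<le> G f ?ws"
    using CallE.prems unfolding calls_ok.simps computes_def by blast
  show ?case
    unfolding exp_value.simps
    by (intro exI conjI, rule eval_CallE[OF t(1) t'(1,2)]) (use t(2) t'(3) in simp)
qed

lemma computesI:
  assumes "f < length p" "calls_ok p F G ws (p ! f)" "exp_value F ws (p ! f) = F f ws"
    and "exp_time F G ws (p ! f) \<le> G f ws"
  shows "computes p F G f ws"
  using eval_exp_value[OF assms(2)] assms(1,3,4) unfolding computes_def by (metis order_trans)


section \<open>A program for the translation\<close>

fun eq_sexp :: "sexp \<Rightarrow> sexp \<Rightarrow> sexp" where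
  "eq_sexp (Pr x y) (Pr z w) = (if eq_sexp x z = Nl then Nl else eq_sexp y w)"
| "eq_sexp Nl Nl = Pr Nl Nl"
| "eq_sexp _ _ = Nl"

fun same_length_sexp :: "sexp \<Rightarrow> sexp \<Rightarrow> sexp" where
  "same_length_sexp (Pr x y) (Pr z w) = same_length_sexp y w"
| "same_length_sexp Nl Nl = Pr Nl Nl"
| "same_length_sexp _ _ = Nl"

text \<open>
  The tags \<open>0\<close> and \<open>1\<close> of clauses and conjunctions have at most one binary digit, the tags
  \<open>2\<close> and \<open>3\<close> of the quantifiers have two.
\<close>

definition is_quantifier_sexp :: "sexp \<Rightarrow> bool" where
  "is_quantifier_sexp \<phi> \<longleftrightarrow> sexp_snd (sexp_fst \<phi>) \<noteq> Nl"

text \<open>The encoded body of a quantifier occupies the slot of a right conjunct, so one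
  projection serves both.\<close>

definition child_sexp :: "sexp \<Rightarrow> sexp \<Rightarrow> sexp" where
  "child_sexp \<phi> b =
     (if is_quantifier_sexp \<phi> \<or> b \<noteq> Nl then sexp_snd (sexp_snd \<phi>) else sexp_fst (sexp_snd \<phi>))"

text \<open>Optional results are represented by \<open>Nl\<close> and \<open>Pr r Nl\<close>.\<close>

definition binding_step_sexp :: "sexp \<Rightarrow> sexp \<Rightarrow> sexp \<Rightarrow> sexp \<Rightarrow> sexp" where
  "binding_step_sexp b r \<phi> v =
     (if r \<noteq> Nl then Pr (Pr b (sexp_fst r)) Nl
      else if is_quantifier_sexp \<phi> then
        (if eq_sexp (sexp_fst (sexp_snd \<phi>)) v \<noteq> Nl then Pr Nl Nl else Nl)
      else Nl)"

fun binding_index_sexp :: "sexp \<Rightarrow> sexp \<Rightarrow> sexp \<Rightarrow> sexp" where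
  "binding_index_sexp \<phi> Nl v = Nl"
| "binding_index_sexp \<phi> (Pr b i) v =
     binding_step_sexp b (binding_index_sexp (child_sexp \<phi> b) i v) \<phi> v"

fun located_vars_sexp :: "sexp \<Rightarrow> sexp \<Rightarrow> sexp \<Rightarrow> sexp" where
  "located_vars_sexp \<phi> i Nl = Nl"
| "located_vars_sexp \<phi> i (Pr l ls) =
     Pr (Pr (sexp_fst (binding_index_sexp \<phi> i (sexp_snd l))) (sexp_snd l))
       (located_vars_sexp \<phi> i ls)"

fun falsifier_sexp :: "sexp \<Rightarrow> sexp" where
  "falsifier_sexp Nl = Nl"
| "falsifier_sexp (Pr l ls) =
     Pr (Pr (sexp_snd l) (if sexp_fst l = Nl then Pr Nl Nl else Nl)) (falsifier_sexp ls)"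

definition label_sexp :: "sexp \<Rightarrow> sexp \<Rightarrow> sexp" where
  "label_sexp \<phi> J = Pr (located_vars_sexp \<phi> (sexp_fst J) (sexp_snd J)) (falsifier_sexp (sexp_snd J))"

text \<open>A node is its label paired with the list of its children, so the equations after the
  default for \<open>Nl\<close> match those of \<open>trace_of\<close>. Enumerations are free of
  repetitions, which allows comparing lengths instead of cardinalities.\<close>

fun trace_sexp :: "sexp \<Rightarrow> sexp \<Rightarrow> sexp" where
  "trace_sexp \<phi> Nl = Nl"
| "trace_sexp \<phi> (Pr J Nl) = Pr (label_sexp \<phi> J) Nl"
| "trace_sexp \<phi> (Pr J (Pr s Nl)) =
     (if same_length_sexp (sexp_snd J) (sexp_snd (sexp_fst s)) \<noteq> Nl then trace_sexp \<phi> s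
      else Pr (label_sexp \<phi> J) (Pr (trace_sexp \<phi> s) Nl))"
| "trace_sexp \<phi> (Pr J (Pr s (Pr t ts))) =
     Pr (label_sexp \<phi> J) (Pr (trace_sexp \<phi> s) (Pr (trace_sexp \<phi> t) Nl))"

abbreviation label_exp :: exp where
  "label_exp \<equiv>
     PrE (CallE 2 [ArgE 0, FstE (FstE (ArgE 1)), SndE (FstE (ArgE 1))])
       (CallE 3 [SndE (FstE (ArgE 1))])"

definition main_exp :: exp where
  "main_exp =
     CallE 1 [FstE (ArgE 0), SndE (ArgE 0)]"

definition trace_exp :: exp where
  "trace_exp =
     IfE (ArgE 1)
       (IfE (SndE (ArgE 1))
         (IfE (SndE (SndE (ArgE 1)))
           (PrE label_exp
             (PrE (CallE 1 [ArgE 0, FstE (SndE (ArgE 1))])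
               (PrE (CallE 1 [ArgE 0, FstE (SndE (SndE (ArgE 1)))]) NlE)))
           (IfE (CallE 7 [SndE (FstE (ArgE 1)), SndE (FstE (FstE (SndE (ArgE 1))))])
             (CallE 1 [ArgE 0, FstE (SndE (ArgE 1))])
             (PrE label_exp (PrE (CallE 1 [ArgE 0, FstE (SndE (ArgE 1))]) NlE))))
         (PrE label_exp NlE))
       NlE"

definition located_vars_exp :: exp where
  "located_vars_exp =
     IfE (ArgE 2)
       (PrE (PrE (FstE (CallE 4 [ArgE 0, ArgE 1, SndE (FstE (ArgE 2))])) (SndE (FstE (ArgE 2))))
         (CallE 2 [ArgE 0, ArgE 1, SndE (ArgE 2)]))
       NlE"

definition falsifier_exp :: exp where
  "falsifier_exp =
     IfE (ArgE 0)
       (PrE (PrE (SndE (FstE (ArgE 0))) (IfE (FstE (FstE (ArgE 0))) NlE (PrE NlE NlE)))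
         (CallE 3 [SndE (ArgE 0)]))
       NlE"

text \<open>The recursive result is passed to function \<open>5\<close> as an argument because the
  language has no local binding: writing the call once for the test and once for the result could
  double the work at every level of the path.\<close>

definition binding_index_exp :: exp where
  "binding_index_exp =
     IfE (ArgE 1)
       (CallE 5
         [FstE (ArgE 1),
          CallE 4
            [IfE (SndE (FstE (ArgE 0))) (SndE (SndE (ArgE 0)))
               (IfE (FstE (ArgE 1)) (SndE (SndE (ArgE 0))) (FstE (SndE (ArgE 0)))),
             SndE (ArgE 1), ArgE 2],
          ArgE 0, ArgE 2])
       NlE"

definition binding_step_exp :: exp where
  "binding_step_exp =
     IfE (ArgE 1) (PrE (PrE (ArgE 0) (FstE (ArgE 1))) NlE)
       (IfE (SndE (FstE (ArgE 2)))
         (IfE (CallE 6 [FstE (SndE (ArgE 2)), ArgE 3]) (PrE NlE NlE) NlE)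
         NlE)"

definition eq_exp :: exp where
  "eq_exp =
     IfE (ArgE 0)
       (IfE (ArgE 1)
         (IfE (CallE 6 [FstE (ArgE 0), FstE (ArgE 1)]) (CallE 6 [SndE (ArgE 0), SndE (ArgE 1)]) NlE)
         NlE)
       (IfE (ArgE 1) NlE (PrE NlE NlE))"

definition same_length_exp :: exp where
  "same_length_exp =
     IfE (ArgE 0)
       (IfE (ArgE 1) (CallE 7 [SndE (ArgE 0), SndE (ArgE 1)]) NlE)
       (IfE (ArgE 1) NlE (PrE NlE NlE))"

definition translator :: program where
  "translator =
     [main_exp, trace_exp, located_vars_exp, falsifier_exp,
      binding_index_exp, binding_step_exp, eq_exp, same_length_exp]"

lemma translator_nth [simp]:
  "translator ! 0 = main_exp"
  "translator ! Suc 0 = trace_exp"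
  "translator ! 2 = located_vars_exp"
  "translator ! 3 = falsifier_exp"
  "translator ! 4 = binding_index_exp"
  "translator ! 5 = binding_step_exp"
  "translator ! 6 = eq_exp"
  "translator ! 7 = same_length_exp"
  "length translator = 8"
  by (simp_all add: translator_def)

definition translator_value :: "nat \<Rightarrow> sexp list \<Rightarrow> sexp" where
  "translator_value f ws =
     (if f = 0 then trace_sexp (sexp_fst (ws ! 0)) (sexp_snd (ws ! 0))
      else if f = 1 then trace_sexp (ws ! 0) (ws ! 1)
      else if f = 2 then located_vars_sexp (ws ! 0) (ws ! 1) (ws ! 2)
      else if f = 3 then falsifier_sexp (ws ! 0)
      else if f = 4 then binding_index_sexp (ws ! 0) (ws ! 1) (ws ! 2)
      else if f = 5 then binding_step_sexp (ws ! 0) (ws ! 1) (ws ! 2) (ws ! 3)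
      else if f = 6 then eq_sexp (ws ! 0) (ws ! 1)
      else same_length_sexp (ws ! 0) (ws ! 1))"

text \<open>Here \<open>N\<close> bounds the sizes of the arguments.\<close>

definition translator_time :: "nat \<Rightarrow> nat \<Rightarrow> sexp list \<Rightarrow> nat" where
  "translator_time N f ws =
     (if f = 0 then 2000 * N ^ 5
      else if f = 1 then sexp_size (ws ! 1) * (1000 * N ^ 4)
      else if f = 2 then sexp_size (ws ! 2) * (400 * N ^ 3)
      else if f = 3 then sexp_size (ws ! 0) * (40 * N)
      else if f = 4 then sexp_size (ws ! 1) * (200 * N ^ 2)
      else if f = 5 then 100 * N ^ 2
      else if f = 6 then sexp_size (ws ! 0) * (40 * N)
      else sexp_size (ws ! 0) * (40 * N))"

lemma translator_value_simps [simp]: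
  "translator_value 0 [w] = trace_sexp (sexp_fst w) (sexp_snd w)"
  "translator_value (Suc 0) [\<phi>, t] = trace_sexp \<phi> t"
  "translator_value 2 [\<phi>, i, ls] = located_vars_sexp \<phi> i ls"
  "translator_value 3 [ls] = falsifier_sexp ls"
  "translator_value 4 [\<phi>, i, v] = binding_index_sexp \<phi> i v"
  "translator_value 5 [b, r, \<phi>, v] = binding_step_sexp b r \<phi> v"
  "translator_value 6 [x, y] = eq_sexp x y"
  "translator_value 7 [x, y] = same_length_sexp x y"
  by (simp_all add: translator_value_def)

lemma translator_time_simps [simp]:
  "translator_time N 0 [w] = 2000 * N ^ 5"
  "translator_time N (Suc 0) [\<phi>, t] = sexp_size t * (1000 * N ^ 4)"
  "translator_time N 2 [\<phi>, i, ls] = sexp_size ls * (400 * N ^ 3)"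
  "translator_time N 3 [ls] = sexp_size ls * (40 * N)"
  "translator_time N 4 [\<phi>, i, v] = sexp_size i * (200 * N ^ 2)"
  "translator_time N 5 [b, r, \<phi>, v] = 100 * N ^ 2"
  "translator_time N 6 [x, y] = sexp_size x * (40 * N)"
  "translator_time N 7 [x, y] = sexp_size x * (40 * N)"
  by (simp_all add: translator_time_def)

abbreviation "translator_computes N \<equiv> computes translator translator_value (translator_time N)"

section \<open>Sizes of results and running times\<close>

lemma sexp_size_pos: "sexp_size x \<ge> 1"
  by (cases x) auto

lemma sexp_size_fst: "sexp_size (sexp_fst x) \<le> sexp_size x"
  by (cases x) auto

lemma sexp_size_snd: "sexp_size (sexp_snd x) \<le> sexp_size x"
  by (cases x) auto

lemma size_eq_sexp: "sexp_size (eq_sexp x y) \<le> 3"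
  by (induction x y rule: eq_sexp.induct) auto

lemma size_same_length_sexp: "sexp_size (same_length_sexp x y) \<le> 3"
  by (induction x y rule: same_length_sexp.induct) auto

text \<open>The recursive calls work on disjoint parts of \<open>Pr x y\<close>, so their bounds add
  up, and the remaining unit of size, worth \<open>40 * N\<close>, together with slack pays for the
  body. The other time bounds of recursive functions follow this pattern.\<close>

lemma computes_eq:
  assumes "sexp_size x \<le> N" "sexp_size y \<le> N"
  shows "translator_computes N 6 [x, y]"
  using assms
proof (induction x y rule: eq_sexp.induct)
  case (1 x y z w)
  have sub: "sexp_size x \<le> N" "sexp_size y \<le> N" "sexp_size z \<le> N" "sexp_size w \<le> N"
    using 1(3,4) by auto
  have c: "translator_computes N 6 [x, z]" "eq_sexp x z \<noteq> Nl \<Longrightarrow> translator_computes N 6 [y, w]"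
    using 1 sub by auto
  show ?case
    by (rule computesI)
      (use c sub 1(3,4) sexp_size_pos[of x] size_eq_sexp[of x z] size_eq_sexp[of y w] in
        \<open>auto simp: eq_exp_def algebra_simps\<close>)
qed (rule computesI; auto simp: eq_exp_def)+

lemma computes_same_length:
  assumes "sexp_size x \<le> N" "sexp_size y \<le> N"
  shows "translator_computes N 7 [x, y]"
  using assms
proof (induction x y rule: same_length_sexp.induct)
  case (1 x y z w)
  have sub: "sexp_size x \<le> N" "sexp_size y \<le> N" "sexp_size z \<le> N" "sexp_size w \<le> N"
    using 1(2,3) by auto
  have c: "translator_computes N 7 [y, w]"
    using 1 sub by auto
  show ?case
    by (rule computesI)
      (use c sub 1(2,3) sexp_size_pos[of x] size_same_length_sexp[of y w] in
        \<open>auto simp: same_length_exp_def algebra_simps\<close>)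
qed (rule computesI; auto simp: same_length_exp_def)+

text \<open>With \<open>k\<close> the size of \<open>i\<close>, the bound is the size of
  \<open>Pr b i\<close> plus 2, as the induction for \<open>binding_index_sexp\<close> requires. The
  2 is the wrapping of an optional result.\<close>

lemma size_binding_step_sexp:
  assumes "sexp_size r \<le> k + 2"
  shows "sexp_size (binding_step_sexp b r \<phi> v) \<le> sexp_size b + k + 3"
  using assms sexp_size_pos[of b] sexp_size_pos[of "sexp_snd r"]
  by (cases r) (auto simp: binding_step_sexp_def)

lemma size_binding_index_sexp: "sexp_size (binding_index_sexp \<phi> i v) \<le> sexp_size i + 2"
proof (induction \<phi> i v rule: binding_index_sexp.induct)
  case (2 \<phi> b i v)
  then show ?case
    using size_binding_step_sexp[OF 2, of b \<phi> v] by simp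
qed simp

lemma size_child_sexp: "sexp_size (child_sexp \<phi> b) \<le> sexp_size \<phi>"
  using sexp_size_fst[of "sexp_snd \<phi>"] sexp_size_snd[of "sexp_snd \<phi>"] sexp_size_snd[of \<phi>]
  by (auto simp: child_sexp_def)

text \<open>Each literal contributes at most 2 * N + 4, which is at most
  \<open>6 * N\<close>.\<close>

lemma size_located_vars_sexp:
  assumes "sexp_size i \<le> N" "sexp_size ls \<le> N"
  shows "sexp_size (located_vars_sexp \<phi> i ls) \<le> sexp_size ls * (6 * N)"
  using assms(2)
proof (induction ls)
  case Nl
  then show ?case by simp
next
  case (Pr l ls)
  have "sexp_size (sexp_fst (binding_index_sexp \<phi> i (sexp_snd l))) \<le> N + 2"
    using sexp_size_fst size_binding_index_sexp assms(1) by (meson add_le_mono1 order_trans)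
  then show ?case
    using Pr sexp_size_snd[of l] by (simp add: algebra_simps)
qed

lemma size_falsifier_sexp: "sexp_size (falsifier_sexp ls) \<le> 3 * sexp_size ls"
proof (induction ls)
  case (Pr l ls)
  then show ?case
    using sexp_size_snd[of l] sexp_size_pos[of l] by simp
qed simp

lemma size_label_sexp:
  assumes "sexp_size J \<le> N"
  shows "sexp_size (label_sexp \<phi> J) \<le> 10 * N ^ 2"
proof -
  have le: "sexp_size (sexp_fst J) \<le> N" "sexp_size (sexp_snd J) \<le> N"
    using sexp_size_fst[of J] sexp_size_snd[of J] assms by linarith+
  have "sexp_size (sexp_snd J) * (6 * N) \<le> 6 * N ^ 2"
    using le(2) by (simp add: power2_eq_square)
  moreover have "1 \<le> N" "N \<le> N ^ 2"
    using assms sexp_size_pos[of J] by (simp_all add: power2_eq_square)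
  ultimately show ?thesis
    using size_located_vars_sexp[OF le, of \<phi>] size_falsifier_sexp[of "sexp_snd J"] le
    by (simp add: label_sexp_def)
qed

lemma size_trace_sexp:
  assumes "sexp_size t \<le> N"
  shows "sexp_size (trace_sexp \<phi> t) \<le> sexp_size t * (20 * N ^ 2)"
proof -
  \<comment> \<open>As an opaque atom the square no longer interferes with the arithmetic.\<close>
  define M where "M = N ^ 2"
  have "M > 0"
    using assms sexp_size_pos[of t] by (simp add: M_def)
  have label: "sexp_size (label_sexp \<phi> J) \<le> 10 * M" if "sexp_size J \<le> N" for J \<phi>
    using size_label_sexp[OF that] by (simp add: M_def)
  show ?thesis
    unfolding M_def[symmetric] using assms
  proof (induction \<phi> t rule: trace_sexp.induct)
    case (2 \<phi> J)
    then show ?case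
      using label[of J \<phi>] \<open>M > 0\<close> by simp
  next
    case (3 \<phi> J s)
    then show ?case
      using label[of J \<phi>] \<open>M > 0\<close> by (auto simp: algebra_simps)
  next
    case (4 \<phi> J s t ts)
    then show ?case
      using label[of J \<phi>] \<open>M > 0\<close> by (auto simp: algebra_simps)
  qed (use \<open>M > 0\<close> in simp)
qed

lemma computes_binding_step:
  assumes "sexp_size b \<le> N" "sexp_size r \<le> N" "sexp_size \<phi> \<le> N" "sexp_size v \<le> N"
  shows "translator_computes N 5 [b, r, \<phi>, v]"
proof -
  let ?u = "sexp_fst (sexp_snd \<phi>)"
  have sub: "sexp_size ?u \<le> N" "sexp_size (sexp_snd \<phi>) \<le> N" "sexp_size (sexp_fst \<phi>) \<le> N"
      "sexp_size (sexp_snd (sexp_fst \<phi>)) \<le> N" "sexp_size (sexp_fst r) \<le> N"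
    using assms sexp_size_fst sexp_size_snd by (meson order_trans)+
  have "translator_computes N 6 [?u, v]"
    by (rule computes_eq) (use sub assms in auto)
  moreover have "sexp_size ?u * (40 * N) \<le> 40 * N ^ 2"
    using sub(1) by (simp add: power2_eq_square)
  moreover have "1 \<le> N" "N \<le> N ^ 2"
    using assms(1) sexp_size_pos[of b] by (simp_all add: power2_eq_square)
  ultimately show ?thesis
    by (intro computesI)
      (use assms sub size_eq_sexp[of ?u v] in
        \<open>auto simp: binding_step_exp_def binding_step_sexp_def is_quantifier_sexp_def\<close>)
qed

lemma computes_binding_index:
  assumes "sexp_size \<phi> \<le> N" "sexp_size i \<le> N" "sexp_size v \<le> N"
  shows "translator_computes N 4 [\<phi>, i, v]"
  using assms
proof (induction \<phi> i v rule: binding_index_sexp.induct)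
  case (1 \<phi> v)
  have "1 \<le> N" "N \<le> N ^ 2"
    using 1(2) by (simp_all add: power2_eq_square)
  then show ?case
    by (intro computesI) (auto simp: binding_index_exp_def)
next
  case (2 \<phi> b i v)
  let ?r = "binding_index_sexp (child_sexp \<phi> b) i v"
  have N: "1 \<le> N" "N \<le> N ^ 2"
    using 2(3) by (simp_all add: power2_eq_square)
  \<comment> \<open>The excess of 2 over the size of \<open>i\<close> is absorbed by the pair
    constructor and \<open>b\<close>, so the intermediate result still respects
    \<open>N\<close>.\<close>
  have r: "sexp_size ?r \<le> N"
    using size_binding_index_sexp[of "child_sexp \<phi> b" i v] 2(3) sexp_size_pos[of b] by simp
  have sub: "sexp_size (sexp_snd \<phi>) \<le> N" "sexp_size (sexp_fst \<phi>) \<le> N"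
      "sexp_size (sexp_snd (sexp_fst \<phi>)) \<le> N" "sexp_size (sexp_snd (sexp_snd \<phi>)) \<le> N"
      "sexp_size (sexp_fst (sexp_snd \<phi>)) \<le> N" "sexp_size (child_sexp \<phi> b) \<le> N"
    using 2(2) sexp_size_fst sexp_size_snd size_child_sexp by (meson order_trans)+
  have c: "translator_computes N 4 [child_sexp \<phi> b, i, v]" "translator_computes N 5 [b, ?r, \<phi>, v]"
    using 2 r sub by (auto intro: computes_binding_step)
  have res: "sexp_size (binding_step_sexp b ?r \<phi> v) \<le> 2 * N + 3"
    using size_binding_step_sexp[OF size_binding_index_sexp[of "child_sexp \<phi> b" i v], of b \<phi> v] 2(3)
    by simp
  show ?case
  proof (rule computesI)
    show "exp_time translator_value (translator_time N) [\<phi>, Pr b i, v] (translator ! 4)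
        \<le> translator_time N 4 [\<phi>, Pr b i, v]"
      using N sub r res 2(2-4)
      by (cases "sexp_snd (sexp_fst \<phi>) = Nl"; cases "b = Nl")
        (simp_all add: binding_index_exp_def child_sexp_def is_quantifier_sexp_def algebra_simps)
  qed (use c in \<open>auto simp: binding_index_exp_def child_sexp_def is_quantifier_sexp_def split: if_splits\<close>)
qed

lemma computes_located_vars:
  assumes "sexp_size \<phi> \<le> N" "sexp_size i \<le> N" "sexp_size ls \<le> N"
  shows "translator_computes N 2 [\<phi>, i, ls]"
  using assms(3)
proof (induction ls)
  case Nl
  then have "1 \<le> N" "N \<le> N ^ 3"
    by (simp_all add: power3_eq_cube)
  then show ?case
    by (intro computesI) (auto simp: located_vars_exp_def)
next
  case (Pr l ls)
  let ?r = "binding_index_sexp \<phi> i (sexp_snd l)"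
  have N: "1 \<le> N" "N \<le> N ^ 2" "N ^ 2 \<le> N ^ 3"
    using Pr.prems power_increasing[of 2 3 N] by (simp_all add: power2_eq_square)
  have r: "sexp_size ?r \<le> N + 2" "sexp_size (sexp_fst ?r) \<le> N + 2"
    using size_binding_index_sexp[of \<phi> i "sexp_snd l"] sexp_size_fst[of ?r] assms(2) by auto
  have sub: "sexp_size (sexp_snd l) \<le> N" "sexp_size ls \<le> N" "sexp_size l \<le> N"
    using Pr.prems sexp_size_snd[of l] by auto
  have c: "translator_computes N 4 [\<phi>, i, sexp_snd l]" "translator_computes N 2 [\<phi>, i, ls]"
    using Pr.IH sub assms by (auto intro: computes_binding_index)
  have "sexp_size i * (200 * N ^ 2) \<le> 200 * N ^ 3"
    using assms(2) by (simp add: power2_eq_square power3_eq_cube)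
  moreover have "sexp_size ls * (6 * N) \<le> 6 * N ^ 2"
    using sub(2) by (simp add: power2_eq_square)
  then have "sexp_size (located_vars_sexp \<phi> i ls) \<le> 6 * N ^ 2"
    using size_located_vars_sexp[OF assms(2) sub(2), of \<phi>] by linarith
  ultimately show ?case
    by (intro computesI)
      (use c N r sub assms Pr.prems in \<open>auto simp: located_vars_exp_def algebra_simps\<close>)
qed

lemma computes_falsifier:
  assumes "sexp_size ls \<le> N"
  shows "translator_computes N 3 [ls]"
  using assms
proof (induction ls)
  case Nl
  then show ?case
    by (intro computesI) (auto simp: falsifier_exp_def)
next
  case (Pr l ls)
  have sub: "sexp_size (sexp_snd l) \<le> N" "sexp_size (sexp_fst l) \<le> N" "sexp_size ls \<le> N"
      "sexp_size l \<le> N" "1 \<le> N"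
    using Pr.prems sexp_size_snd[of l] sexp_size_fst[of l] by auto
  have c: "translator_computes N 3 [ls]"
    using Pr.IH sub by auto
  have "N \<le> sexp_size l * N"
    using sexp_size_pos[of l] by simp
  then show ?case
    by (intro computesI)
      (use c sub Pr.prems size_falsifier_sexp[of ls] in \<open>auto simp: falsifier_exp_def algebra_simps\<close>)
qed

lemma mult_power_le:
  fixes x N :: nat
  assumes "x \<le> N" "m = Suc k"
  shows "x * N ^ k \<le> N ^ m"
  using assms by simp

lemma computes_trace:
  assumes "sexp_size \<phi> \<le> N" "sexp_size t \<le> N"
  shows "translator_computes N (Suc 0) [\<phi>, t]"
proof -
  have N: "1 \<le> N" "N \<le> N ^ 2" "N ^ 2 \<le> N ^ 3" "N ^ 3 \<le> N ^ 4"
    using assms(2) sexp_size_pos[of t] power_increasing[of 1 2 N] power_increasing[of 2 3 N]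
      power_increasing[of 3 4 N] by simp_all
  have label:
    "translator_computes N 2 [\<phi>, sexp_fst J, sexp_snd J]" "translator_computes N 3 [sexp_snd J]"
    "sexp_size (sexp_fst J) \<le> N" "sexp_size (sexp_snd J) \<le> N"
    "sexp_size (located_vars_sexp \<phi> (sexp_fst J) (sexp_snd J)) \<le> 6 * N ^ 2"
    "sexp_size (falsifier_sexp (sexp_snd J)) \<le> 3 * N"
    "sexp_size (sexp_snd J) * (400 * N ^ 3) \<le> 400 * N ^ 4"
    "sexp_size (sexp_snd J) * (40 * N) \<le> 40 * N ^ 2"
    if "sexp_size J \<le> N" for J
  proof -
    show le: "sexp_size (sexp_fst J) \<le> N" "sexp_size (sexp_snd J) \<le> N"
      using that sexp_size_fst[of J] sexp_size_snd[of J] by linarith+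
    show "translator_computes N 2 [\<phi>, sexp_fst J, sexp_snd J]" "translator_computes N 3 [sexp_snd J]"
      using computes_located_vars[OF assms(1) le] computes_falsifier[OF le(2)] by simp_all
    have "sexp_size (sexp_snd J) * (6 * N) \<le> 6 * N ^ 2"
      using le(2) by (simp add: power2_eq_square)
    then show "sexp_size (located_vars_sexp \<phi> (sexp_fst J) (sexp_snd J)) \<le> 6 * N ^ 2"
      using size_located_vars_sexp[OF le, of \<phi>] by linarith
    show "sexp_size (falsifier_sexp (sexp_snd J)) \<le> 3 * N"
      using size_falsifier_sexp[of "sexp_snd J"] le(2) by linarith
    show "sexp_size (sexp_snd J) * (400 * N ^ 3) \<le> 400 * N ^ 4"
      "sexp_size (sexp_snd J) * (40 * N) \<le> 40 * N ^ 2"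
      using mult_power_le[OF le(2), of 4 3] mult_power_le[OF le(2), of 2 1] by simp_all
  qed
  have trace: "sexp_size (trace_sexp \<phi> s) \<le> 20 * N ^ 3" if "sexp_size s \<le> N" for s
  proof -
    have "sexp_size s * (20 * N ^ 2) \<le> 20 * N ^ 3"
      using mult_power_le[OF that, of 3 2] by simp
    then show ?thesis
      using size_trace_sexp[OF that, of \<phi>] by linarith
  qed
  \<comment> \<open>The powers become atoms related only by the chain in \<open>N\<close>, which
    keeps the time estimates simple.\<close>
  define A B C where "A = N ^ 2" and "B = N ^ 3" and "C = N ^ 4"
  note folds = A_def[symmetric] B_def[symmetric] C_def[symmetric]
  note N = N[unfolded folds]
  show ?thesis
    using assms(2)
  \<comment> \<open>The formula is fixed throughout, so the induction predicate ignores the first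
    argument.\<close>
  proof (induction t rule: trace_sexp.induct[of "\<lambda>_ t. _ t", case_names leaf0 leaf unary binary])
    case leaf0
    show ?case
      by (rule computesI) (use N in \<open>auto simp: folds trace_exp_def\<close>)
  next
    case (leaf _ J)
    then have "sexp_size J \<le> N"
      by simp
    note label = label[OF this, unfolded folds]
    show ?case
      by (rule computesI)
        (use N label assms(1) leaf in \<open>auto simp: folds trace_exp_def label_sexp_def algebra_simps\<close>)
  next
    case (unary _ J s)
    then have le: "sexp_size J \<le> N" "sexp_size s \<le> N"
      by auto
    have sub: "sexp_size (sexp_fst s) \<le> N" "sexp_size (sexp_snd (sexp_fst s)) \<le> N"
      using le(2) sexp_size_fst sexp_size_snd by (meson order_trans)+
    note label = label[OF le(1), unfolded folds] and trace = trace[OF le(2), unfolded folds]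
    let ?b = "same_length_sexp (sexp_snd J) (sexp_snd (sexp_fst s))"
    have c: "translator_computes N 7 [sexp_snd J, sexp_snd (sexp_fst s)]"
      using computes_same_length label(4) sub(2) by simp
    \<comment> \<open>The hypotheses are guarded by the outcome of the length test, but both
      branches recurse on \<open>s\<close>.\<close>
    have IH: "translator_computes N (Suc 0) [\<phi>, s]"
      using unary le by (cases "?b = Nl") auto
    show ?case
      by (rule computesI)
        (use N label trace c IH sub assms(1) unary.prems
          size_same_length_sexp[of "sexp_snd J" "sexp_snd (sexp_fst s)"] in
          \<open>auto simp: folds trace_exp_def label_sexp_def algebra_simps\<close>)
  next
    case (binary _ J s t ts)
    then have le: "sexp_size J \<le> N" "sexp_size s \<le> N" "sexp_size t \<le> N"
      by auto
    have IH: "translator_computes N (Suc 0) [\<phi>, s]" "translator_computes N (Suc 0) [\<phi>, t]"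
      using binary le by auto
    note label = label[OF le(1), unfolded folds] and trace = trace[OF le(2), unfolded folds] trace[OF le(3), unfolded folds]
    show ?case
      by (rule computesI)
        (use N label trace IH assms(1) binary.prems in
          \<open>auto simp: folds trace_exp_def label_sexp_def algebra_simps\<close>)
  qed
qed

lemma computes_main: "translator_computes (sexp_size w) 0 [w]"
proof -
  define N where "N = sexp_size w"
  have le: "sexp_size (sexp_fst w) \<le> N" "sexp_size (sexp_snd w) \<le> N"
    using sexp_size_fst[of w] sexp_size_snd[of w] by (auto simp: N_def)
  have N: "1 \<le> N" "N \<le> N ^ 5" "N ^ 3 \<le> N ^ 5"
    using sexp_size_pos[of w] power_increasing[of 1 5 N] power_increasing[of 3 5 N]
    by (simp_all add: N_def)
  have "sexp_size (sexp_snd w) * (20 * N ^ 2) \<le> 20 * N ^ 3"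
    "sexp_size (sexp_snd w) * (1000 * N ^ 4) \<le> 1000 * N ^ 5"
    using mult_power_le[OF le(2), of 3 2] mult_power_le[OF le(2), of 5 4] by simp_all
  then show ?thesis
    unfolding N_def[symmetric]
    by (intro computesI)
      (use le N computes_trace[OF le] size_trace_sexp[OF le(2), of "sexp_fst w"] N_def in
        \<open>auto simp: main_exp_def\<close>)
qed

text \<open>The slack between 2000 and 3000 pays for the outer call: N for fetching the argument and
  at most 20 * N^3 for the result.\<close>

lemma eval_translator:
  "\<exists>t. eval translator [w] (CallE 0 [ArgE 0]) (trace_sexp (sexp_fst w) (sexp_snd w)) t \<and>
     t \<le> 3000 * sexp_size w ^ 5"
proof -
  define N where "N = sexp_size w"
  have le: "sexp_size (sexp_snd w) \<le> N"
    using sexp_size_snd[of w] by (auto simp: N_def)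
  have N: "1 \<le> N" "N \<le> N ^ 5" "N ^ 3 \<le> N ^ 5"
    using sexp_size_pos[of w] power_increasing[of 1 5 N] power_increasing[of 3 5 N]
    by (simp_all add: N_def)
  have "sexp_size (sexp_snd w) * (20 * N ^ 2) \<le> 20 * N ^ 3"
    using mult_power_le[OF le, of 3 2] by simp
  then have "sexp_size (trace_sexp (sexp_fst w) (sexp_snd w)) \<le> 20 * N ^ 3"
    using size_trace_sexp[OF le, of "sexp_fst w"] by linarith
  then have "exp_time translator_value (translator_time N) [w] (CallE 0 [ArgE 0]) \<le> 3000 * N ^ 5"
    using N by (simp add: N_def[symmetric])
  moreover have "calls_ok translator translator_value (translator_time N) [w] (CallE 0 [ArgE 0])"
    using computes_main[of w] by (simp add: N_def)
  ultimately show ?thesis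
    using eval_exp_value[of translator translator_value "translator_time N" "[w]" "CallE 0 [ArgE 0]"]
    by (auto simp: N_def intro: order_trans)
qed


section \<open>Correctness of the program\<close>

lemma eq_sexp_iff: "eq_sexp x y \<noteq> Nl \<longleftrightarrow> x = y"
  by (induction x y rule: eq_sexp.induct) auto

lemma same_length_sexp_iff:
  "same_length_sexp (enc_list xs) (enc_list ys) \<noteq> Nl \<longleftrightarrow> length xs = length ys"
proof (induction xs arbitrary: ys)
  case Nil
  then show ?case by (cases ys) auto
next
  case (Cons x xs)
  then show ?case by (cases ys) auto
qed

lemma enc_bool_eq_Nl [simp]: "enc_bool b = Nl \<longleftrightarrow> \<not> b"
  by (cases b) auto

lemma enc_bool_inject [simp]: "enc_bool b = enc_bool c \<longleftrightarrow> b = c"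
  by (cases b; cases c) auto

text \<open>A number is determined by its parity and its half. Thus the program may compare
  variables by comparing codes.\<close>

lemma enc_nat_inject [simp]: "enc_nat m = enc_nat n \<longleftrightarrow> m = n"
proof (induction m arbitrary: n rule: less_induct)
  case (less m)
  show ?case
  proof (cases "m = 0 \<or> n = 0")
    case True
    then show ?thesis
      by (subst (1 2) enc_nat.simps) auto
  next
    case False
    then have "enc_nat m = enc_nat n \<longleftrightarrow> odd m = odd n \<and> m div 2 = n div 2"
      using less[of "m div 2" "n div 2"] by (subst (1 2) enc_nat.simps) auto
    also have "\<dots> \<longleftrightarrow> m = n"
      by presburger
    finally show ?thesis .
  qed
qed

lemma enc_nat_tags:
  "enc_nat 0 = Nl" "enc_nat (Suc 0) = Pr (Pr Nl Nl) Nl" "enc_nat 2 = Pr Nl (Pr (Pr Nl Nl) Nl)"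
  "enc_nat 3 = Pr (Pr Nl Nl) (Pr (Pr Nl Nl) Nl)"
  by (simp_all add: enc_nat.simps)

lemma rep_qcbf_child:
  assumes "rep_qcbf \<psi> w" "subformula \<psi> (b # i) \<noteq> None"
  shows "rep_qcbf (child_formula \<psi> b) (child_sexp w (enc_bool b))"
  using assms by (cases \<psi>) (auto simp: child_sexp_def is_quantifier_sexp_def enc_nat_tags)

lemma quantifies_sexp:
  assumes "rep_qcbf \<psi> w"
  shows "is_quantifier_sexp w \<and> sexp_fst (sexp_snd w) = enc_nat v \<longleftrightarrow> quantifies \<psi> v"
  using assms by (cases \<psi>) (auto simp: is_quantifier_sexp_def enc_nat_tags)

lemma binding_index_sexp:
  assumes "rep_qcbf \<psi> w" "subformula \<psi> i \<noteq> None"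
  shows "binding_index_sexp w (enc_index i) (enc_nat v) =
    (case binding_index \<psi> i v of None \<Rightarrow> Nl | Some j \<Rightarrow> Pr (enc_index j) Nl)"
  using assms
proof (induction i arbitrary: \<psi> w)
  case Nil
  then show ?case
    by (simp add: enc_index_def)
next
  case (Cons b i)
  have "binding_index_sexp (child_sexp w (enc_bool b)) (enc_index i) (enc_nat v) =
    (case binding_index (child_formula \<psi> b) i v of None \<Rightarrow> Nl | Some j \<Rightarrow> Pr (enc_index j) Nl)"
    using Cons.IH rep_qcbf_child Cons.prems subformula_child by metis
  then show ?case
    using quantifies_sexp[OF Cons.prems(1), of v]
    by (auto simp: enc_index_def binding_step_sexp_def eq_sexp_iff split: option.splits)
qed

lemma located_vars_sexp:
  assumes "rep_qcbf \<psi> w" "subformula \<psi> i \<noteq> None"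
    and "\<And>L. L \<in> set Ls \<Longrightarrow> binding_index \<psi> i (var_of L) \<noteq> None"
  shows "located_vars_sexp w (enc_index i) (enc_list (map enc_literal Ls)) =
    enc_list (map (\<lambda>L. enc_located_var (the (binding_index \<psi> i (var_of L)), var_of L)) Ls)"
  using assms(3)
proof (induction Ls)
  case (Cons L Ls)
  have "sexp_snd (enc_literal L) = enc_nat (var_of L)"
    by (cases L) auto
  moreover obtain j where "binding_index \<psi> i (var_of L) = Some j"
    using Cons.prems[of L] by auto
  ultimately show ?case
    using Cons binding_index_sexp[OF assms(1,2), of "var_of L"] by (simp add: enc_located_var_def)
qed simp

lemma falsifier_sexp:
  "falsifier_sexp (enc_list (map enc_literal Ls)) =
    enc_list (map (\<lambda>L. enc_binding (var_of L, case L of Pos _ \<Rightarrow> False | Neg _ \<Rightarrow> True)) Ls)"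
proof (induction Ls)
  case (Cons L Ls)
  then show ?case
    by (cases L) (auto simp: enc_binding_def)
qed simp

text \<open>Ensures that a repetition-free list of literals yields repetition-free lists of binders
  and of bindings, as the representation of sets demands.\<close>

lemma inj_on_var_of: "is_clause \<alpha> \<Longrightarrow> inj_on var_of \<alpha>"
  unfolding is_clause_def inj_on_def by (metis var_of.elims)

lemma rep_label_sexp:
  assumes "free \<psi> = {}" "rep_qcbf \<psi> w" "clause_judgement \<psi> J" "rep_judgement J x"
  shows "rep_trace_label (label_of \<psi> J) (label_sexp w x)"
proof -
  obtain i \<alpha> where J: "J = (i, \<alpha>)"
    by fastforce
  note D = clause_judgementD[OF assms(3)[unfolded J]]
  obtain Ls where Ls: "distinct Ls" "set Ls = \<alpha>" "x = Pr (enc_index i) (enc_list (map enc_literal Ls))"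
    using assms(4) by (auto simp: rep_judgement_def rep_set_def J)
  have inj: "inj_on var_of (set Ls)"
    using inj_on_var_of D(2) Ls(2) by simp
  let ?loc = "\<lambda>L. (the (binding_index \<psi> i (var_of L)), var_of L)"
  let ?val = "\<lambda>L. (var_of L, case L of Pos _ \<Rightarrow> False | Neg _ \<Rightarrow> True)"
  have sub: "subformula \<psi> i \<noteq> None"
    using D(1) by (simp add: indices_def)
  have bound: "binding_index \<psi> i (var_of L) \<noteq> None" if "L \<in> set Ls" for L
  proof -
    have "var_of L \<in> free (sub_at \<psi> i)"
      using that Ls(2) D(3) by (auto simp: vars_clause_def)
    then show ?thesis
      using binding_index_follows[OF assms(1) D(1)] by (metis option.distinct(1))
  qed
  have dist: "distinct (map ?loc Ls)" "distinct (map ?val Ls)"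
    using Ls(1) inj by (auto simp: distinct_map inj_on_def)
  have loc: "set (map ?loc Ls) = located_vars \<psi> i (vars_clause \<alpha>)"
    using Ls(2) by (auto simp: located_vars_def vars_clause_def)
  have val: "set (map ?val Ls) = Map.graph (falsifier \<alpha>)"
  proof -
    \<comment> \<open>A binding of \<open>v\<close> to \<open>b\<close> corresponds to the one
      literal on \<open>v\<close> that it makes false.\<close>
    have "(v, b) = ?val L \<longleftrightarrow> L = (if b then Neg v else Pos v)" for v b L
      by (cases L) auto
    then have "(v, b) \<in> ?val ` \<alpha> \<longleftrightarrow> (if b then Neg v else Pos v) \<in> \<alpha>" for v b
      unfolding image_iff by simp
    also have "(if b then Neg v else Pos v) \<in> \<alpha> \<longleftrightarrow> falsifier \<alpha> v = Some b" for v b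
      using D(2) by (auto simp: falsifier_def is_clause_def)
    finally show ?thesis
      unfolding set_map Ls(2) Map.graph_def by (simp add: set_eq_iff)
  qed
  have "located_vars_sexp w (enc_index i) (enc_list (map enc_literal Ls)) =
      enc_list (map enc_located_var (map ?loc Ls))"
    using located_vars_sexp[OF assms(2) sub bound] by (simp add: comp_def)
  then have "rep_set enc_located_var (located_vars \<psi> i (vars_clause \<alpha>))
      (located_vars_sexp w (enc_index i) (enc_list (map enc_literal Ls)))"
    using dist(1) loc unfolding rep_set_def by blast
  moreover have "falsifier_sexp (enc_list (map enc_literal Ls)) =
      enc_list (map enc_binding (map ?val Ls))"
    using falsifier_sexp[of Ls] by (simp add: comp_def)
  then have "rep_set enc_binding (Map.graph (falsifier \<alpha>))
      (falsifier_sexp (enc_list (map enc_literal Ls)))"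
    using dist(2) val unfolding rep_set_def by blast
  ultimately show ?thesis
    by (simp add: rep_trace_label_def J label_of_def label_sexp_def Ls(3))
qed

lemma rep_trace_sexp:
  assumes "free \<psi> = {}" "rep_qcbf \<psi> w" "proof_tree \<psi> P" "rep_rtree rep_judgement P y"
  shows "rep_rtree rep_trace_label (trace_of \<psi> P) (trace_sexp w y)"
  using assms(3,4)
proof (induction P arbitrary: y rule: proof_tree.induct)
  case (node J ts)
  from node.prems obtain x ws where y: "y = Pr x (enc_list ws)" and x: "rep_judgement J x"
    and ws: "list_all2 (rep_rtree rep_judgement) ts ws"
    by (auto elim: rep_rtree.cases)
  note label = rep_label_sexp[OF assms(1,2) node.hyps(1) x]
  have IH: "rep_rtree rep_trace_label (trace_of \<psi> t) (trace_sexp w z)"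
    if "t \<in> set ts" "rep_rtree rep_judgement t z" for t z
    using node.IH that by blast
  \<comment> \<open>The types of inference have zero, one or two predecessors, which are the shapes
    told apart by \<open>trace_of\<close> and \<open>trace_sexp\<close>.\<close>
  from node.hyps(2) consider "ts = []" | t where "ts = [t]" | s t where "ts = [s, t]"
    by (auto simp: by_clause_def by_resolve_def by_upward_flow_def by_all_removal_def
        by_downward_flow_def)
  then show ?case
  proof cases
    case 1
    then show ?thesis
      using ws rep_rtree.intros[where R = rep_trace_label, OF label, of "[]" "[]"] by (simp add: y)
  next
    case (2 t)
    then obtain z where z: "ws = [z]" "rep_rtree rep_judgement t z"
      using ws by (auto simp: list_all2_Cons1)
    from z(2) have root: "rep_judgement (root_label t) (sexp_fst z)"
      by (cases rule: rep_rtree.cases) simp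
    from x obtain Ls where Ls: "distinct Ls" "snd J = set Ls"
      "sexp_snd x = enc_list (map enc_literal Ls)"
      by (auto simp: rep_judgement_def rep_set_def)
    from root obtain Ms where Ms: "distinct Ms" "snd (root_label t) = set Ms"
      "sexp_snd (sexp_fst z) = enc_list (map enc_literal Ms)"
      by (auto simp: rep_judgement_def rep_set_def)
    have "same_length_sexp (sexp_snd x) (sexp_snd (sexp_fst z)) \<noteq> Nl \<longleftrightarrow>
        card (snd J) = card (snd (root_label t))"
      using same_length_sexp_iff[of "map enc_literal Ls" "map enc_literal Ms"]
      by (simp add: Ls Ms distinct_card)
    then show ?thesis
      using IH[of t z] z 2 rep_rtree.intros[where R = rep_trace_label, OF label, of "[trace_of \<psi> t]" "[trace_sexp w z]"]
      by (auto simp: y)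
  next
    case (3 s t)
    then obtain z z' where z: "ws = [z, z']" "rep_rtree rep_judgement s z" "rep_rtree rep_judgement t z'"
      using ws by (auto simp: list_all2_Cons1)
    then show ?thesis
      using IH[of s z] IH[of t z'] 3
        rep_rtree.intros[where R = rep_trace_label, OF label, of "[trace_of \<psi> s, trace_of \<psi> t]" "[trace_sexp w z, trace_sexp w z']"]
      by (auto simp: y)
  qed
qed

theorem theoremB1:
  "\<exists>translate :: qcbf \<times> judgement rtree \<Rightarrow> trace_label rtree.
     (\<forall>\<psi> P. qcbf_instance \<psi> \<and> tree_like_empty_clause_proof \<psi> P \<longrightarrow>
        is_trace \<psi> (translate (\<psi>, P)) \<and>
        root_label (translate (\<psi>, P)) = ({}, Map.empty) \<and>
        num_nodes (translate (\<psi>, P)) = num_nonflow \<psi> P) \<and>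
     polytime_computable_on {(\<psi>, P). qcbf_instance \<psi> \<and> tree_like_empty_clause_proof \<psi> P}
       rep_input (rep_rtree rep_trace_label) translate"
proof (intro exI[of _ "\<lambda>(\<psi>, P). trace_of \<psi> P"] conjI allI impI)
  have D: "free \<psi> = {} \<and> proof_tree \<psi> P \<and> snd (root_label P) = {}"
    if "qcbf_instance \<psi> \<and> tree_like_empty_clause_proof \<psi> P" for \<psi> P
  proof -
    from that obtain \<Pi> k where "is_cj_proof \<psi> \<Pi>" "k < length \<Pi>" "snd (judgement_at \<Pi> k) = {}"
      "P = induced_tree \<Pi> k"
      unfolding tree_like_empty_clause_proof_def by blast
    moreover from this have "root_label P = judgement_at \<Pi> k"
      by (simp add: induced_tree.simps[of \<Pi> k])
    ultimately show ?thesis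
      using that proof_tree_induced by (simp add: qcbf_instance_def)
  qed
  {
    fix \<psi> P
    assume "qcbf_instance \<psi> \<and> tree_like_empty_clause_proof \<psi> P"
    note D = D[OF this]
    have "label_of \<psi> (root_label P) = ({}, Map.empty)"
      using D by (simp add: label_of_def located_vars_def vars_clause_def falsifier_def fun_eq_iff)
    then show "is_trace \<psi> (case (\<psi>, P) of (\<psi>, P) \<Rightarrow> trace_of \<psi> P)"
      "root_label (case (\<psi>, P) of (\<psi>, P) \<Rightarrow> trace_of \<psi> P) = ({}, Map.empty)"
      "num_nodes (case (\<psi>, P) of (\<psi>, P) \<Rightarrow> trace_of \<psi> P) = num_nonflow \<psi> P"
      using trace_of_correct[of \<psi> P] D by simp_all
  }
  show "polytime_computable_on {(\<psi>, P). qcbf_instance \<psi> \<and> tree_like_empty_clause_proof \<psi> P}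
       rep_input (rep_rtree rep_trace_label) (\<lambda>(\<psi>, P). trace_of \<psi> P)"
    unfolding polytime_computable_on_def
  proof (rule exI[of _ translator], rule exI[of _ 3000], rule exI[of _ 5], intro ballI allI impI)
    fix X w
    assume X: "X \<in> {(\<psi>, P). qcbf_instance \<psi> \<and> tree_like_empty_clause_proof \<psi> P}"
      and w: "rep_input X w"
    obtain \<psi> P where XP: "X = (\<psi>, P)"
      by fastforce
    from w obtain x y where xy: "rep_qcbf \<psi> x" "rep_rtree rep_judgement P y" "w = Pr x y"
      by (auto simp: rep_input_def XP)
    have "rep_rtree rep_trace_label (trace_of \<psi> P) (trace_sexp x y)"
      using rep_trace_sexp D[of \<psi> P] X xy XP by simp
    then show "\<exists>w' t. eval translator [w] (CallE 0 [ArgE 0]) w' t \<and>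
        rep_rtree rep_trace_label (case X of (\<psi>, P) \<Rightarrow> trace_of \<psi> P) w' \<and>
        t \<le> 3000 * sexp_size w ^ 5"
      using eval_translator[of w] by (auto simp: XP xy(3))
  qed
qed

end
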